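(* Let $n\ge2$, $a\ge1$ and $1\le m\le k\le n-1$ be integers, $\lambda=(a^k,1^{n-k-1},0)$, $\nu=\lambda-(e_m+e_{m+1}+\cdots+e_k)$, and let $\mu,\rho$ be such that $\lambda,\mu,\nu,\rho$ are partitions (vectors in $\mathbb{Z}^n$ with last entry $0$) with $\lambda+\mu=\nu+\rho$ and $\nu,\rho\in P_{\lambda,\mu}$. Then the procedure $\theta$ described in the context is well defined on every $\lambda\circledast\mu$-peelable tableau (every square it requires exists and the procedure terminates), and $\theta$ is an injection from the set of $\lambda\circledast\mu$-peelable tableaux to the set of $\nu\circledast\rho$-peelable tableaux.
   Context: $e_i$ is the $i$-th standard basis vector of $\mathbb{Z}^n$. For weights $\lambda,\mu$, $P_{\lambda,\mu}$ is the minimal alcoved polytope containing $\lambda,\mu$ (alcoved polytope: intersection of half-spaces bounded by hyperplanes $\tau_i-\tau_j=c$, $c\in\mathbb{Z}$); equivalently $\tau\in P_{\lambda,\mu}$ iff for all $1\le i,j\le n$, $\tau_i-\tau_j$ lies weakly between $\lambda_i-\lambda_j$ and $\mu_i-\mu_j$. English convention: $(i,j)$ is row $i$ (top to bottom), column $j$; North = up, East = right, West = left. For partitions $\alpha,\beta$ the shuffle diagram $\alpha\circledast\beta$ has a square at $(2i-1,2j-1)$ for each square $(i,j)$ of $\alpha$ and at $(2i,2j)$ for each square $(i,j)$ of $\beta$; let $a_i$ be the number of its columns containing squares in both rows $i$ and $i+2$. An $\alpha\circledast\beta$-peelable tableau is a semistandard Young tableau with content $(\alpha_1,\beta_1,\alpha_2,\beta_2,\ldots)$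 such that for every $i\ge1$ there are at least $a_i$ pairwise disjoint pairs (square containing $i$, square containing $i+2$) with the $i$-square in a row weakly above and a column weakly right of the $(i+2)$-square. In a semistandard tableau, a square containing $2i-1$ is changeable if it is the rightmost $(2i-1)$-square in its row and the square directly below it does not contain $2i$ (so it can be increased to $2i$ keeping semistandardness); a square containing $2i$ is changeable if it is the leftmost $2i$-square in its row and the square directly above it does not contain $2i-1$ (so it can be decreased to $2i-1$). The procedure $\theta$ applied to a $\lambda\circledast\mu$-peelable tableau $T$: (1) let $s_m$ be the leftmost changeable $(2m-1)$-square and change its entry to $2m$; (2) for $j=m+1,\ldots,k$ in turn, let $s_j$ be the leftmost changeable $(2j-1)$-square weakly East of $s_{j-1}$ in the current tableau, and change its entry to $2j$; (3) if the current tableau is $\nu\circledast\rho$-peelable, stop; otherwise let $s_{k+1}$ be the unique $(2k+1)$-square and $t_{k+1}$ the rightmost changeable $(2k+2)$-square, increase $s_{k+1}$ to $2k+2$ and decrease $t_{k+1}$ to $2k+1$; (4) if the current tableau is $\nu\circledast\rho$-peelable, stop; otherwise repeat step (3) with $2k+3,2k+4$ in place of $2k+1,2k+2$ (squares $s_{k+2},t_{k+2}$), then with $2k+5,2k+6$, and so on, until the current tableau is $\nu\circledast\rho$-peelable. $\theta(T)$ is the resulting tableau. *)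

theory Defs
  imports Complex_Main
begin

text \<open>
  A vector of \<open>\<int>\<^sup>n\<close> is a function \<open>nat \<Rightarrow> int\<close> with coordinates indexed by \<open>{1..n}\<close> that
  vanishes outside \<open>{1..n}\<close>; diagrams, contents and tableaux below all use indices starting at 1.
\<close>

definition int_vector :: "nat \<Rightarrow> (nat \<Rightarrow> int) \<Rightarrow> bool" where
  "int_vector n x \<longleftrightarrow> (\<forall>i. i \<notin> {1..n} \<longrightarrow> x i = 0)"

definition std_basis :: "nat \<Rightarrow> nat \<Rightarrow> int" where
  "std_basis i = (\<lambda>j. if j = i then 1 else 0)"

definition is_partition :: "nat \<Rightarrow> (nat \<Rightarrow> int) \<Rightarrow> bool" where
  "is_partition n x \<longleftrightarrow>
     int_vector n x \<and> (\<forall>i j. 1 \<le> i \<and> i \<le> j \<and> j \<le> n \<longrightarrow> x j \<le> x i) \<and> x n = 0"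


section \<open>Alcoved polytopes\<close>

text \<open>Half-spaces \<open>\<tau>\<^sub>i - \<tau>\<^sub>j \<ge> c\<close> are obtained by exchanging \<open>i\<close> and \<open>j\<close>.\<close>

definition alcoved_halfspaces :: "nat \<Rightarrow> (nat \<Rightarrow> real) set set" where
  "alcoved_halfspaces n =
     {{\<tau>. \<tau> i - \<tau> j \<le> of_int c} | i j (c :: int). i \<in> {1..n} \<and> j \<in> {1..n} \<and> i \<noteq> j}"

definition alcoved_polytope :: "nat \<Rightarrow> (nat \<Rightarrow> real) set \<Rightarrow> bool" where
  "alcoved_polytope n P \<longleftrightarrow> (\<exists>H. finite H \<and> H \<subseteq> alcoved_halfspaces n \<and> P = \<Inter> H)"

definition min_alcoved_polytope :: "nat \<Rightarrow> (nat \<Rightarrow> int) \<Rightarrow> (nat \<Rightarrow> int) \<Rightarrow> (nat \<Rightarrow> real) set" where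
  "min_alcoved_polytope n \<alpha> \<beta> =
     \<Inter> {P. alcoved_polytope n P \<and> (\<lambda>i. of_int (\<alpha> i)) \<in> P \<and> (\<lambda>i. of_int (\<beta> i)) \<in> P}"

lemma mem_min_alcoved_polytope_iff:
  "(\<lambda>i. of_int (\<tau> i)) \<in> min_alcoved_polytope n \<alpha> \<beta> \<longleftrightarrow>
     (\<forall>i \<in> {1..n}. \<forall>j \<in> {1..n}.
        min (\<alpha> i - \<alpha> j) (\<beta> i - \<beta> j) \<le> \<tau> i - \<tau> j \<and>
        \<tau> i - \<tau> j \<le> max (\<alpha> i - \<alpha> j) (\<beta> i - \<beta> j))"
  (is "?L \<longleftrightarrow> ?R")
proof
  assume L: ?L
  have up: "\<tau> i - \<tau> j \<le> max (\<alpha> i - \<alpha> j) (\<beta> i - \<beta> j)" if "i \<in> {1..n}" "j \<in> {1..n}" for i j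
  proof (cases "i = j")
    case False
    define c where "c = max (\<alpha> i - \<alpha> j) (\<beta> i - \<beta> j)"
    define h where "h = {x :: nat \<Rightarrow> real. x i - x j \<le> of_int c}"
    have "h \<in> alcoved_halfspaces n"
      using that False unfolding alcoved_halfspaces_def h_def by blast
    hence "alcoved_polytope n h"
      unfolding alcoved_polytope_def by (intro exI[of _ "{h}"]) auto
    moreover have "(\<lambda>i. of_int (\<alpha> i)) \<in> h" "(\<lambda>i. of_int (\<beta> i)) \<in> h"
      unfolding h_def c_def by (auto simp flip: of_int_diff)
    ultimately have "(\<lambda>i. of_int (\<tau> i)) \<in> h"
      using L unfolding min_alcoved_polytope_def by blast
    thus ?thesis
      unfolding h_def c_def by (auto simp flip: of_int_diff)
  qed auto
  have "min (\<alpha> i - \<alpha> j) (\<beta> i - \<beta> j) \<le> \<tau> i - \<tau> j" if "i \<in> {1..n}" "j \<in> {1..n}" for i j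
    using up[OF that(2,1)] by linarith
  with up show ?R by blast
next
  assume R: ?R
  have "(\<lambda>i. of_int (\<tau> i)) \<in> h"
    if 1: "H \<subseteq> alcoved_halfspaces n" "h \<in> H"
      "(\<lambda>i. of_int (\<alpha> i)) \<in> \<Inter> H" "(\<lambda>i. of_int (\<beta> i)) \<in> \<Inter> H" for H h
  proof -
    have h_in: "(\<lambda>i. of_int (\<alpha> i)) \<in> h" "(\<lambda>i. of_int (\<beta> i)) \<in> h"
      using 1 by blast+
    obtain i j c where h: "h = {x. x i - x j \<le> of_int c}" and ij: "i \<in> {1..n}" "j \<in> {1..n}"
      using 1(1,2) unfolding alcoved_halfspaces_def by blast
    have "\<alpha> i - \<alpha> j \<le> c" "\<beta> i - \<beta> j \<le> c"
      using h_in unfolding h by (auto simp flip: of_int_diff)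
    moreover have "\<tau> i - \<tau> j \<le> max (\<alpha> i - \<alpha> j) (\<beta> i - \<beta> j)"
      using R ij by blast
    ultimately have "\<tau> i - \<tau> j \<le> c"
      by linarith
    thus ?thesis
      unfolding h by (simp flip: of_int_diff)
  qed
  thus ?L
    unfolding min_alcoved_polytope_def alcoved_polytope_def by blast
qed


section \<open>Shuffle diagrams and peelable tableaux\<close>

type_synonym square = "nat \<times> nat"

text \<open>\<open>T (r, c) = Some v\<close> means that the square in row \<open>r\<close> (counted from the top) and column \<open>c\<close>
  (counted from the left) contains \<open>v\<close>; the shape of \<open>T\<close> is \<open>dom T\<close>.\<close>

type_synonym filling = "square \<rightharpoonup> nat"

definition diagram :: "(nat \<Rightarrow> int) \<Rightarrow> square set" where
  "diagram \<alpha> = {(i, j). 1 \<le> i \<and> 1 \<le> j \<and> int j \<le> \<alpha> i}"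

definition shuffle_diagram :: "(nat \<Rightarrow> int) \<Rightarrow> (nat \<Rightarrow> int) \<Rightarrow> square set" where
  "shuffle_diagram \<alpha> \<beta> =
     {(2 * i - 1, 2 * j - 1) | i j. (i, j) \<in> diagram \<alpha>} \<union>
     {(2 * i, 2 * j) | i j. (i, j) \<in> diagram \<beta>}"

definition row_overlap :: "(nat \<Rightarrow> int) \<Rightarrow> (nat \<Rightarrow> int) \<Rightarrow> nat \<Rightarrow> nat" where
  "row_overlap \<alpha> \<beta> i =
     card {c. (i, c) \<in> shuffle_diagram \<alpha> \<beta> \<and> (i + 2, c) \<in> shuffle_diagram \<alpha> \<beta>}"

definition semistandard :: "filling \<Rightarrow> bool" where
  "semistandard T \<longleftrightarrow>
     (\<exists>N \<gamma>. is_partition N \<gamma> \<and> dom T = diagram \<gamma>) \<and>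
     (\<forall>v \<in> ran T. 1 \<le> v) \<and>
     (\<forall>r c c' v v'. T (r, c) = Some v \<and> T (r, c') = Some v' \<and> c < c' \<longrightarrow> v \<le> v') \<and>
     (\<forall>r r' c v v'. T (r, c) = Some v \<and> T (r', c) = Some v' \<and> r < r' \<longrightarrow> v < v')"

definition interleaved_content :: "(nat \<Rightarrow> int) \<Rightarrow> (nat \<Rightarrow> int) \<Rightarrow> nat \<Rightarrow> int" where
  "interleaved_content \<alpha> \<beta> v = (if odd v then \<alpha> ((v + 1) div 2) else \<beta> (v div 2))"

definition squares_with :: "filling \<Rightarrow> nat \<Rightarrow> square set" where
  "squares_with T v = {q. T q = Some v}"

definition peelable :: "(nat \<Rightarrow> int) \<Rightarrow> (nat \<Rightarrow> int) \<Rightarrow> filling \<Rightarrow> bool" where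
  "peelable \<alpha> \<beta> T \<longleftrightarrow>
     semistandard T \<and>
     (\<forall>v \<ge> 1. int (card (squares_with T v)) = interleaved_content \<alpha> \<beta> v) \<and>
     (\<forall>i \<ge> 1. \<exists>M. finite M \<and> row_overlap \<alpha> \<beta> i \<le> card M \<and>
        M \<subseteq> squares_with T i \<times> squares_with T (i + 2) \<and>
        (\<forall>(p, q) \<in> M. fst p \<le> fst q \<and> snd q \<le> snd p) \<and>
        pairwise (\<lambda>(p, q) (p', q'). {p, q} \<inter> {p', q'} = {}) M)"


section \<open>The procedure \<open>\<theta>\<close>\<close>

definition changeable :: "filling \<Rightarrow> square \<Rightarrow> bool" where
  "changeable T = (\<lambda>(r, c). \<exists>j \<ge> 1.
     (T (r, c) = Some (2 * j - 1) \<and>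
        (\<forall>c'. T (r, c') = Some (2 * j - 1) \<longrightarrow> c' \<le> c) \<and> T (r + 1, c) \<noteq> Some (2 * j)) \<or>
     (T (r, c) = Some (2 * j) \<and>
        (\<forall>c'. T (r, c') = Some (2 * j) \<longrightarrow> c \<le> c') \<and> T (r - 1, c) \<noteq> Some (2 * j - 1)))"

text \<open>The selection functions return \<open>None\<close> unless exactly one square qualifies.\<close>

definition the_square :: "square set \<Rightarrow> square option" where
  "the_square S = (if \<exists>!q. q \<in> S then Some (THE q. q \<in> S) else None)"

definition leftmost :: "square set \<Rightarrow> square option" where
  "leftmost S = the_square {q \<in> S. \<forall>q' \<in> S. snd q \<le> snd q'}"

definition rightmost :: "square set \<Rightarrow> square option" where
  "rightmost S = the_square {q \<in> S. \<forall>q' \<in> S. snd q' \<le> snd q}"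

text \<open>One choice of \<open>s\<^sub>j\<close> among the squares in column \<open>c\<close> or further East; the column of \<open>s\<^sub>j\<close> is
  returned along with the new filling. With \<open>c = 0\<close> there is no restriction on the column.\<close>

definition raise_step :: "nat \<Rightarrow> filling \<times> nat \<Rightarrow> (filling \<times> nat) option" where
  "raise_step j = (\<lambda>(T, c).
     Option.bind (leftmost {q \<in> squares_with T (2 * j - 1). changeable T q \<and> c \<le> snd q})
       (\<lambda>s. Some (T(s \<mapsto> 2 * j), snd s)))"

text \<open>\<open>raise_steps m d\<close> performs the choices of \<open>s\<^sub>m, s\<^bsub>m+1\<^esub>, \<dots>, s\<^bsub>m+d\<^esub>\<close>.\<close>

primrec raise_steps :: "nat \<Rightarrow> nat \<Rightarrow> filling \<Rightarrow> (filling \<times> nat) option" where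
  "raise_steps m 0 T = raise_step m (T, 0)"
| "raise_steps m (Suc d) T = Option.bind (raise_steps m d T) (raise_step (m + Suc d))"

text \<open>Both squares are selected in \<open>T\<close>, before either entry is changed.\<close>

definition swap_step :: "nat \<Rightarrow> filling \<Rightarrow> filling option" where
  "swap_step j T =
     Option.bind (the_square (squares_with T (2 * j - 1))) (\<lambda>s.
     Option.bind (rightmost {q \<in> squares_with T (2 * j). changeable T q}) (\<lambda>t.
     Some (T(s \<mapsto> 2 * j, t \<mapsto> 2 * j - 1))))"

text \<open>\<open>None\<close> results both from a missing square and from non-termination.\<close>

partial_function (option) swap_until_peelable ::
    "(nat \<Rightarrow> int) \<Rightarrow> (nat \<Rightarrow> int) \<Rightarrow> nat \<Rightarrow> filling \<Rightarrow> filling option" where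
  "swap_until_peelable \<nu> \<rho> j T =
     (if peelable \<nu> \<rho> T then Some T
      else Option.bind (swap_step j T) (swap_until_peelable \<nu> \<rho> (j + 1)))"

definition theta ::
    "nat \<Rightarrow> nat \<Rightarrow> (nat \<Rightarrow> int) \<Rightarrow> (nat \<Rightarrow> int) \<Rightarrow> filling \<Rightarrow> filling option" where
  "theta m k \<nu> \<rho> T =
     Option.bind (raise_steps m (k - m) T) (\<lambda>(T', _). swap_until_peelable \<nu> \<rho> (k + 1) T')"

end

theory Submission
  imports Defs
begin

text \<open>
  A semistandard tableau is encoded by the sets \<open>C v\<close> of columns containing the letter \<open>v\<close>. A family of
  sets comes from a tableau iff each \<open>ht C v\<close>, the number of letters at most \<open>v\<close> in a given column,
  is weakly decreasing, and the pairing condition says that \<open>C v\<close> dominates \<open>C (v + 2)\<close>.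

  Since the first \<open>k\<close> parts of \<open>lam\<close> are equal to \<open>a\<close>, domination forces \<open>C (2 * j - 1) = {1..a}\<close> for
  \<open>j \<le> k\<close>. The hypotheses on the alcoved polytope say that fewer than \<open>a\<close> columns contain \<open>2 * m\<close> and
  that strictly more contain \<open>2 * (m - 1)\<close>; this provides the squares to raise, and choosing them
  leftmost makes the domination of \<open>C (2 * j)\<close> by \<open>C (2 * (j - 1))\<close> strict between the columns of
  consecutive raised squares. After raising, the only condition that can fail is the one for the
  letters \<open>2 * k - 1\<close> and \<open>2 * k + 1\<close>, and each swap moves the possible failure two letters up. A failure
  forces all even letters involved to lie strictly West of the next odd letter to be swapped.

  For injectivity, the raised column is the one missing from \<open>{1..a}\<close>, and a swap is undone by
  exchanging the single odd letter with the Easternmost even one; this position is incompatible with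
  a preimage in which fewer swaps occurred.
\<close>

section \<open>Tableaux as families of column sets\<close>

text \<open>Rows i and i + 2 of the shuffle diagram carry squares of the same partition, so
  \<open>row_overlap\<close> at i is the full number of letters i + 2. The pairing must therefore
  use every (i + 2)-square, and a Hall condition on column sets replaces the search for pairs.

  The obstacle is that each s_j is picked by a local rule, whereas domination counts all columns
  further East; nor is it clear that a changeable square remains available for every j. Both points
  are settled by an auxiliary column f attached to each raised column s: from f to s the letter 2j
  is absent and the height for 2j - 1 is constant, and the number of letters 2j weakly East of f,
  plus f, never exceeds \<open>card (B m) + 1\<close>. As \<open>card (B m) < a\<close>, room is
  left for the next square. The same bound governs the first failure after raising: it forces f = a,
  hence \<open>card (B m) = a - 1\<close>. In this extreme case the alcove inequality for the
  coordinates m and n - 1 makes mu_(n-1) positive, so every later swap finds an even letter.\<close>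

primrec ht :: "(nat \<Rightarrow> nat set) \<Rightarrow> nat \<Rightarrow> nat \<Rightarrow> nat" where
  "ht C 0 c = 0"
| "ht C (Suc v) c = ht C v c + of_bool (c \<in> C (Suc v))"

definition tab :: "(nat \<Rightarrow> nat set) \<Rightarrow> filling" where
  "tab C = (\<lambda>(r, c). if \<exists>v\<ge>1. c \<in> C v \<and> ht C v c = r
     then Some (THE v. 1 \<le> v \<and> c \<in> C v \<and> ht C v c = r) else None)"

definition cols :: "filling \<Rightarrow> nat \<Rightarrow> nat set" where
  "cols T v = snd ` squares_with T v"

text \<open>Index 0 is left free since no letter is 0. Column strictness needs no clause: stacking
  the letters of a column in increasing order enforces it.\<close>

definition valid :: "(nat \<Rightarrow> nat set) \<Rightarrow> bool" where
  "valid C \<longleftrightarrow> (\<forall>v\<ge>1. finite (C v) \<and> 0 \<notin> C v) \<and> (\<exists>N. \<forall>v>N. C v = {}) \<and>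
     (\<forall>v c. 1 \<le> c \<longrightarrow> ht C v (Suc c) \<le> ht C v c)"

lemma ht_mono: "v \<le> w \<Longrightarrow> ht C v c \<le> ht C w c"
  by (induction w) (auto simp: le_Suc_eq)

lemma ht_less: "v < w \<Longrightarrow> c \<in> C w \<Longrightarrow> ht C v c < ht C w c"
  using ht_mono[of v "w - 1" C c] by (cases w) auto

lemma ht_le: "ht C v c \<le> v"
  by (induction v) auto

lemma ht_card: "ht C v c = card {u \<in> {1..v}. c \<in> C u}"
proof (induction v)
  case (Suc v)
  have "{u \<in> {1..Suc v}. c \<in> C u} =
    (if c \<in> C (Suc v) then insert (Suc v) {u \<in> {1..v}. c \<in> C u} else {u \<in> {1..v}. c \<in> C u})"
    by (auto simp: le_Suc_eq)
  then show ?case using Suc by simp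
qed simp

lemma ht_cong: "(\<And>u. 1 \<le> u \<Longrightarrow> C u = D u) \<Longrightarrow> ht C v c = ht D v c"
  by (induction v) auto

lemma ht_inj:
  assumes "c \<in> C v" "c \<in> C w" "ht C v c = ht C w c"
  shows "v = w"
  using ht_less[of v w c C] ht_less[of w v c C] assms by (metis nat_neq_iff)

lemma tab_eq_Some: "tab C (r, c) = Some v \<longleftrightarrow> 1 \<le> v \<and> c \<in> C v \<and> ht C v c = r"
proof -
  have "(THE v. 1 \<le> v \<and> c \<in> C v \<and> ht C v c = r) = v" if "1 \<le> v" "c \<in> C v" "ht C v c = r" for v
    using that ht_inj by (intro the_equality) auto
  then show ?thesis unfolding tab_def by auto
qed

lemma tab_eqI:
  assumes "\<And>r c v. T (r, c) = Some v \<longleftrightarrow> 1 \<le> v \<and> c \<in> C v \<and> ht C v c = r"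
  shows "T = tab C"
proof
  fix q
  have "T q = Some v \<longleftrightarrow> tab C q = Some v" for v
    using assms tab_eq_Some by (cases q) simp
  then show "T q = tab C q"
    by (metis option.exhaust)
qed

lemma tab_cong: "(\<And>u. 1 \<le> u \<Longrightarrow> C u = D u) \<Longrightarrow> tab C = tab D"
  by (rule tab_eqI) (auto simp: tab_eq_Some ht_cong[of C D])

lemma squares_with_tab: "1 \<le> v \<Longrightarrow> squares_with (tab C) v = (\<lambda>c. (ht C v c, c)) ` C v"
  by (auto simp: squares_with_def tab_eq_Some)

lemma cols_tab: "1 \<le> v \<Longrightarrow> cols (tab C) v = C v"
  by (simp add: cols_def squares_with_tab image_image)

lemma cols_iff: "c \<in> cols T v \<longleftrightarrow> (\<exists>r. T (r, c) = Some v)"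
  by (force simp: cols_def squares_with_def)

text \<open>The letters v and \<open>Suc v\<close> are adjacent and column s lacks the latter, so
  the move changes a single height, that of v in column s. The new letter thus lands in the row of
  the old one.\<close>

lemma tab_raise:
  assumes v: "1 \<le> v" and s: "s \<in> C v" "s \<notin> C (Suc v)"
    and D: "D = C(v := C v - {s}, Suc v := insert s (C (Suc v)))"
  shows "(tab C)((ht C v s, s) \<mapsto> Suc v) = tab D"
proof (rule tab_eqI)
  have ht_D: "ht D w c = ht C w c - of_bool (w = v \<and> c = s)" for w c
  proof (induction w)
    case (Suc w)
    show ?case
    proof (cases "Suc w = v")
      case True
      then show ?thesis using Suc s by (auto simp: D)
    next
      case False
      have "ht C v s \<ge> 1" using ht_less[of 0 v s C] v s by auto
      then show ?thesis using False Suc s by (auto simp: D)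
    qed
  qed simp
  have pos: "ht C v s \<ge> 1" using ht_less[of 0 v s C] v s by auto
  fix r c w
  show "((tab C)((ht C v s, s) \<mapsto> Suc v)) (r, c) = Some w \<longleftrightarrow> 1 \<le> w \<and> c \<in> D w \<and> ht D w c = r"
  proof (cases "c = s")
    case True
    have "ht C w s = ht C v s \<longleftrightarrow> w = v" if "s \<in> C w"
      using ht_inj[of s C w v] that s(1) by blast
    moreover have "ht C (Suc v) s = ht C v s" using s by simp
    ultimately show ?thesis
      using True s pos v unfolding ht_D by (auto simp: D tab_eq_Some)
  next
    case False
    then show ?thesis unfolding ht_D by (auto simp: D tab_eq_Some)
  qed
qed

lemma tab_lower:
  assumes v: "1 \<le> v" and s: "s \<notin> C v" "s \<in> C (Suc v)"
    and D: "D = C(v := insert s (C v), Suc v := C (Suc v) - {s})"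
  shows "(tab C)((ht C (Suc v) s, s) \<mapsto> v) = tab D"
proof -
  have DC: "(tab D)((ht D v s, s) \<mapsto> Suc v) = tab C"
    by (rule tab_raise) (use v s in \<open>auto simp: D fun_eq_iff\<close>)
  have "ht D w s = ht C w s" if "w < v" for w
    using that by (induction w) (auto simp: D)
  then have "ht D v s = ht C (Suc v) s"
    using v s by (cases v) (auto simp: D)
  moreover have "tab D (ht D v s, s) = Some v" using v by (simp add: tab_eq_Some D)
  ultimately show ?thesis
    unfolding DC[symmetric] by (auto simp: fun_eq_iff)
qed

lemma valid_finite: "valid C \<Longrightarrow> 1 \<le> v \<Longrightarrow> finite (C v)"
  and valid_pos: "valid C \<Longrightarrow> 1 \<le> v \<Longrightarrow> c \<in> C v \<Longrightarrow> 1 \<le> c"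
  unfolding valid_def by (auto simp: Suc_le_eq intro: gr0I)

lemma valid_antimono:
  assumes "valid C" "1 \<le> c" "c \<le> d"
  shows "ht C v d \<le> ht C v c"
  using assms(3)
proof (induction d rule: dec_induct)
  case (step d)
  then have "ht C v (Suc d) \<le> ht C v d" using assms unfolding valid_def by auto
  then show ?case using step by simp
qed simp

lemma semistandard_tab:
  assumes C: "valid C"
  shows "semistandard (tab C)"
proof -
  obtain N where N: "C v = {}" if "v > N" for v using C unfolding valid_def by auto
  have htN: "ht C v c = ht C (min v N) c" for v c
  proof (induction v)
    case (Suc v)
    show ?case
    proof (cases "Suc v \<le> N")
      case False
      then have "ht C (Suc v) c = ht C v c" "min v N = N" "min (Suc v) N = N" using N[of "Suc v"] by auto
      then show ?thesis using Suc by metis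
    qed (simp add: min_absorb1)
  qed simp
  \<comment> \<open>The columns with at least i squares. They form an initial segment, so row i has
    length \<open>card (S i)\<close>.\<close>
  define S where "S i = {c. 1 \<le> c \<and> i \<le> ht C N c}" for i
  have "S i \<subseteq> (\<Union>v\<in>{1..N}. C v)" if "1 \<le> i" for i
  proof
    fix c assume "c \<in> S i"
    then have "ht C N c \<noteq> 0" using that by (auto simp: S_def)
    then have "{u \<in> {1..N}. c \<in> C u} \<noteq> {}" unfolding ht_card by (metis card.empty)
    then show "c \<in> (\<Union>v\<in>{1..N}. C v)" by auto
  qed
  moreover have "finite (\<Union>v\<in>{1..N}. C v)" using valid_finite[OF C] by auto
  ultimately have finS: "finite (S i)" if "1 \<le> i" for i using that finite_subset by blast
  have S_iff: "c \<le> card (S i) \<longleftrightarrow> c \<in> S i" if i: "1 \<le> i" and c: "1 \<le> c" for i c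
  proof
    assume "c \<in> S i"
    then have "i \<le> ht C N d" if "d \<in> {1..c}" for d
      using valid_antimono[OF C, of d c N] that by (simp add: S_def)
    then have "{1..c} \<subseteq> S i" by (auto simp: S_def)
    from card_mono[OF finS[OF i] this] show "c \<le> card (S i)" by simp
  next
    assume le: "c \<le> card (S i)"
    show "c \<in> S i"
    proof (rule ccontr)
      assume no: "c \<notin> S i"
      have "S i \<subseteq> {1..<c}"
      proof
        fix d assume d: "d \<in> S i"
        then have "\<not> c \<le> d" using no c valid_antimono[OF C c, of d N] by (auto simp: S_def)
        then show "d \<in> {1..<c}" using d by (auto simp: S_def)
      qed
      then have "card (S i) \<le> c - 1" using card_mono[of "{1..<c}" "S i"] by simp
      then show False using le c by simp
    qed
  qed
  define \<gamma> where "\<gamma> i = (if i = 0 then 0 else int (card (S i)))" for i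
  \<comment> \<open>No column is longer than N; the extra index provides the last part 0.\<close>
  have "is_partition (Suc N) \<gamma>"
  proof -
    have "S i = {}" if "i > N" for i
    proof -
      have "\<not> i \<le> ht C N c" for c using ht_le[of C N c] that by linarith
      then show ?thesis by (simp add: S_def)
    qed
    then have "int_vector (Suc N) \<gamma>" "\<gamma> (Suc N) = 0"
      by (simp_all add: int_vector_def \<gamma>_def not_le Suc_le_eq)
    moreover have "\<gamma> j \<le> \<gamma> i" if "1 \<le> i" "i \<le> j" for i j
    proof -
      have "S j \<subseteq> S i" using that by (auto simp: S_def)
      then have "card (S j) \<le> card (S i)" using finS[OF that(1)] card_mono by blast
      then show ?thesis using that by (simp add: \<gamma>_def)
    qed
    ultimately show ?thesis unfolding is_partition_def by blast
  qed
  moreover have "dom (tab C) = diagram \<gamma>"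
  proof (rule set_eqI)
    fix q :: square
    obtain r c where q: "q = (r, c)" by (cases q)
    show "q \<in> dom (tab C) \<longleftrightarrow> q \<in> diagram \<gamma>"
    proof
      assume "q \<in> dom (tab C)"
      then obtain v where v: "1 \<le> v" "c \<in> C v" "ht C v c = r" by (auto simp: q tab_eq_Some)
      then have "1 \<le> r" using ht_less[of 0 v c C] by auto
      moreover have "1 \<le> c" using valid_pos[OF C] v by auto
      moreover have "r \<le> ht C N c" using htN[of v c] v ht_mono[of "min v N" N C c] by simp
      ultimately show "q \<in> diagram \<gamma>" using S_iff[of r c] by (auto simp: q diagram_def \<gamma>_def S_def)
    next
      assume "q \<in> diagram \<gamma>"
      then have r: "1 \<le> r" "1 \<le> c" "c \<in> S r"
        using S_iff[of r c] by (auto simp: q diagram_def \<gamma>_def split: if_splits)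
      \<comment> \<open>Heights grow by at most one per letter, so the first letter whose height
        reaches r stands exactly in row r.\<close>
      define v where "v = (LEAST v. r \<le> ht C v c)"
      have v: "r \<le> ht C v c" unfolding v_def by (rule LeastI[of _ N]) (use r in \<open>auto simp: S_def\<close>)
      then have "v \<noteq> 0" using r by (intro notI) simp
      then obtain w where w: "v = Suc w" by (cases v) auto
      have "\<not> r \<le> ht C w c" using not_less_Least[of w "\<lambda>v. r \<le> ht C v c"] w v_def by simp
      then have "c \<in> C v \<and> ht C v c = r" using v w by (cases "c \<in> C (Suc w)") auto
      then have "tab C (r, c) = Some v" using w by (auto simp: tab_eq_Some)
      then show "q \<in> dom (tab C)" by (auto simp: q)
    qed
  qed
  moreover have "v \<le> v'" if "tab C (r, c) = Some v" "tab C (r, c') = Some v'" "c < c'" for r c c' v v'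
  proof (rule ccontr)
    assume "\<not> v \<le> v'"
    then have "ht C v' c < ht C v c" using that ht_less[of v' v c C] by (auto simp: tab_eq_Some)
    moreover have "ht C v' c' \<le> ht C v' c"
      by (rule valid_antimono[OF C]) (use that valid_pos[OF C] in \<open>auto simp: tab_eq_Some\<close>)
    ultimately show False using that by (auto simp: tab_eq_Some)
  qed
  moreover have "v < v'" if "tab C (r, c) = Some v" "tab C (r', c) = Some v'" "r < r'" for r r' c v v'
    using that ht_mono[of v' v C c] by (fastforce simp: tab_eq_Some)
  moreover have "1 \<le> v" if "v \<in> ran (tab C)" for v
    using that by (auto simp: ran_def tab_eq_Some)
  ultimately show ?thesis unfolding semistandard_def by blast
qed

text \<open>The rows 1 to r of a column hold exactly its letters up to the entry in row r, which
  identifies rows with heights. Antimonotonicity comes from the left neighbour of a letter: it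
  stands in the same row and is no larger.\<close>

lemma
  assumes T: "semistandard T"
  shows valid_cols: "valid (cols T)" and tab_cols: "tab (cols T) = T"
proof -
  obtain N \<gamma> where \<gamma>: "is_partition N \<gamma>" "dom T = diagram \<gamma>"
    using T unfolding semistandard_def by blast
  have pos: "1 \<le> v" if "T q = Some v" for q v
    using T that unfolding semistandard_def by (metis ranI)
  have row: "v \<le> v'" if "T (r, c) = Some v" "T (r, c') = Some v'" "c \<le> c'" for r c c' v v'
  proof (cases "c = c'")
    case False
    then have "c < c'" using that by simp
    then show ?thesis using T that unfolding semistandard_def by blast
  qed (use that in simp)
  have col: "v < v'" if "T (r, c) = Some v" "T (r', c) = Some v'" "r < r'" for r r' c v v'
    using T that unfolding semistandard_def by blast
  have dom: "(\<exists>v. T (r, c) = Some v) \<longleftrightarrow> 1 \<le> r \<and> 1 \<le> c \<and> int c \<le> \<gamma> r" for r c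
    using \<gamma>(2) by (auto simp: diagram_def dom_def set_eq_iff)
  have \<gamma>0: "\<gamma> r = 0" if "r > N" for r
    using \<gamma>(1) that unfolding is_partition_def int_vector_def by auto
  have \<gamma>_mono: "\<gamma> r' \<le> \<gamma> r" if "1 \<le> r" "r \<le> r'" "0 < \<gamma> r'" for r r'
    using \<gamma>(1) \<gamma>0[of r'] that unfolding is_partition_def by (cases "r' \<le> N") auto
  have "dom T \<subseteq> {..N} \<times> {..nat (\<gamma> 1)}"
  proof
    fix q assume q: "q \<in> dom T"
    obtain r c where rc: "q = (r, c)" by (cases q)
    then have *: "1 \<le> r" "1 \<le> c" "int c \<le> \<gamma> r" using q \<gamma>(2) by (auto simp: diagram_def)
    then have "r \<le> N" using \<gamma>0[of r] by (cases "r > N") auto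
    moreover have "\<gamma> r \<le> \<gamma> 1" using \<gamma>_mono[of 1 r] * by auto
    ultimately show "q \<in> {..N} \<times> {..nat (\<gamma> 1)}" using * rc by auto
  qed
  then have fin: "finite (dom T)" using finite_subset by blast
  have fin_sq: "finite (squares_with T v)" for v
    by (rule finite_subset[OF _ fin]) (auto simp: squares_with_def)
  have ht_row: "ht (cols T) v c = r" if rc: "T (r, c) = Some v" for r c v
  proof -
    have r: "1 \<le> r" "1 \<le> c" "int c \<le> \<gamma> r" using dom[of r c] rc by auto
    have ex: "\<exists>u. T (r', c) = Some u" if "r' \<in> {1..r}" for r'
      using that r \<gamma>_mono[of r' r] dom[of r' c] by auto
    have bij: "bij_betw (\<lambda>r'. the (T (r', c))) {1..r} {u \<in> {1..v}. c \<in> cols T u}"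
      unfolding bij_betw_def
    proof
      show "inj_on (\<lambda>r'. the (T (r', c))) {1..r}"
      proof (rule linorder_inj_onI)
        fix x y assume "x < y" "x \<in> {1..r}" "y \<in> {1..r}"
        then show "the (T (x, c)) \<noteq> the (T (y, c))"
          using ex[of x] ex[of y] col[of x c _ y] by force
      qed auto
      show "(\<lambda>r'. the (T (r', c))) ` {1..r} = {u \<in> {1..v}. c \<in> cols T u}"
      proof (intro equalityI subsetI)
        fix u assume "u \<in> (\<lambda>r'. the (T (r', c))) ` {1..r}"
        then obtain r' where r': "r' \<in> {1..r}" "T (r', c) = Some u" using ex by force
        have "u \<le> v" using r' rc col[of r' c u r v] by (cases "r' = r") auto
        then show "u \<in> {u \<in> {1..v}. c \<in> cols T u}" using r' pos by (auto simp: cols_iff)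
      next
        fix u assume "u \<in> {u \<in> {1..v}. c \<in> cols T u}"
        then obtain r' where r': "T (r', c) = Some u" "u \<le> v" by (auto simp: cols_iff)
        then have "r' \<le> r" using col[OF rc r'(1)] by (metis not_le)
        moreover have "1 \<le> r'" using dom[of r' c] r' by auto
        ultimately show "u \<in> (\<lambda>r'. the (T (r', c))) ` {1..r}" using r' by force
      qed
    qed
    show ?thesis using bij_betw_same_card[OF bij] by (simp add: ht_card)
  qed
  show "tab (cols T) = T"
    by (rule tab_eqI[symmetric]) (use ht_row pos in \<open>auto simp: cols_iff\<close>)
  have "ht (cols T) v (Suc c) \<le> ht (cols T) v c" if c: "1 \<le> c" for v c
  proof (induction v)
    case (Suc v)
    show ?case
    proof (cases "Suc c \<in> cols T (Suc v)")
      case True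
      then obtain r where r: "T (r, Suc c) = Some (Suc v)" by (auto simp: cols_iff)
      then have "1 \<le> r \<and> int (Suc c) \<le> \<gamma> r" using dom[of r "Suc c"] by auto
      then obtain u where u: "T (r, c) = Some u" using dom[of r c] c by auto
      then have "u \<le> Suc v" using row[OF u r] by simp
      then have "ht (cols T) u c \<le> ht (cols T) (Suc v) c" by (rule ht_mono)
      then show ?thesis using ht_row[OF u] ht_row[OF r] by simp
    next
      case False
      then show ?thesis using Suc by simp
    qed
  qed simp
  moreover have "finite (cols T v)" for v using fin_sq by (simp add: cols_def)
  moreover have "0 \<notin> cols T v" for v
    using dom[of _ 0] by (auto simp: cols_iff)
  moreover have "\<exists>N. \<forall>v>N. cols T v = {}"
  proof -
    have "finite (ran T)" using fin by (rule finite_ran)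
    then obtain N where "\<forall>v\<in>ran T. v \<le> N" using finite_nat_set_iff_bounded_le by blast
    then have "\<forall>v>N. cols T v = {}" by (force simp: cols_iff ran_def)
    then show ?thesis ..
  qed
  ultimately show "valid (cols T)" unfolding valid_def by blast
qed

section \<open>Peelability in terms of column sets\<close>

definition tail :: "nat set \<Rightarrow> nat \<Rightarrow> nat" where
  "tail X c = card {x \<in> X. c \<le> x}"

text \<open>Hall's condition for an injection from Y into X that never moves an element West; on a
  linear order it suffices to test final segments.\<close>

definition dominates :: "nat set \<Rightarrow> nat set \<Rightarrow> bool" where
  "dominates X Y \<longleftrightarrow> (\<forall>c. tail Y c \<le> tail X c)"

lemma tail_insert: "finite X \<Longrightarrow> s \<notin> X \<Longrightarrow> tail (insert s X) c = tail X c + of_bool (c \<le> s)"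
proof -
  assume "finite X" "s \<notin> X"
  moreover have "{x \<in> insert s X. c \<le> x} = (if c \<le> s then insert s {x \<in> X. c \<le> x} else {x \<in> X. c \<le> x})"
    by auto
  ultimately show ?thesis unfolding tail_def by simp
qed

lemma tail_remove: "finite X \<Longrightarrow> s \<in> X \<Longrightarrow> tail X c = tail (X - {s}) c + of_bool (c \<le> s)"
  using tail_insert[of "X - {s}" s c] by (simp add: insert_absorb)

lemma tail_Suc: "finite X \<Longrightarrow> tail X c = tail X (Suc c) + of_bool (c \<in> X)"
proof -
  assume "finite X"
  moreover have "{x \<in> X. c \<le> x} = (if c \<in> X then insert c {x \<in> X. Suc c \<le> x} else {x \<in> X. Suc c \<le> x})"
    by (auto simp: Suc_le_eq le_less)
  ultimately show ?thesis unfolding tail_def by simp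
qed

lemma tail_antimono: "finite X \<Longrightarrow> c \<le> d \<Longrightarrow> tail X d \<le> tail X c"
  unfolding tail_def by (intro card_mono) auto

lemma tail_eq_card: "(\<And>x. x \<in> X \<Longrightarrow> c \<le> x) \<Longrightarrow> tail X c = card X"
  unfolding tail_def by (rule arg_cong[of _ _ card]) auto

lemma tail_eq_0: "(\<And>x. x \<in> X \<Longrightarrow> x < c) \<Longrightarrow> tail X c = 0"
  unfolding tail_def by (metis (no_types, lifting) Collect_empty_eq card.empty leD)

lemma tail_pos: "finite X \<Longrightarrow> x \<in> X \<Longrightarrow> c \<le> x \<Longrightarrow> 0 < tail X c"
  unfolding tail_def by (auto simp: card_gt_0_iff)

lemma tail_posD: "0 < tail X c \<Longrightarrow> \<exists>x\<in>X. c \<le> x"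
  unfolding tail_def by (auto simp: card_gt_0_iff)

lemma dominates_ex: "finite Y \<Longrightarrow> dominates X Y \<Longrightarrow> y \<in> Y \<Longrightarrow> \<exists>x\<in>X. y \<le> x"
  using tail_pos[of Y y y] tail_posD[of X y] unfolding dominates_def
  by (meson order_refl less_le_trans)

text \<open>Greedy matching from the East: the largest element b of Y goes to \<open>Max X\<close>.
  Removing both lowers the two tails by one at every c up to b, and beyond b nothing of Y is left to
  match.\<close>

lemma dominates_inj:
  assumes "finite Y" "finite X" "dominates X Y"
  shows "\<exists>f. inj_on f Y \<and> f ` Y \<subseteq> X \<and> (\<forall>y\<in>Y. y \<le> f y)"
  using assms
proof (induction Y arbitrary: X rule: finite_linorder_max_induct)
  case empty
  then show ?case by simp
next
  case (insert b A)
  have bA: "b \<notin> A" using insert by auto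
  obtain x where x: "x \<in> X" "b \<le> x" using dominates_ex[of "insert b A" X b] insert by auto
  define M where "M = Max X"
  have M: "M \<in> X" "b \<le> M" "\<And>x. x \<in> X \<Longrightarrow> x \<le> M"
    using x insert.prems unfolding M_def by (auto intro: Max_in order_trans[OF _ Max_ge])
  have "dominates (X - {M}) A"
    unfolding dominates_def
  proof
    fix c
    show "tail A c \<le> tail (X - {M}) c"
    proof (cases "c \<le> b")
      case True
      have "tail (insert b A) c \<le> tail X c" using insert.prems by (simp add: dominates_def)
      then show ?thesis
        using tail_insert[of A b c] tail_remove[of X M c] insert bA M True by auto
    next
      case False
      then have "tail A c = 0" using insert.hyps by (intro tail_eq_0) auto
      then show ?thesis by simp
    qed
  qed
  then obtain f where f: "inj_on f A" "f ` A \<subseteq> X - {M}" "\<forall>y\<in>A. y \<le> f y"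
    using insert.IH[of "X - {M}"] insert.prems by auto
  have "inj_on (f(b := M)) (insert b A)"
    using f bA by (auto simp: inj_on_def)
  moreover have "f(b := M) ` insert b A \<subseteq> X" using f M bA by auto
  moreover have "\<forall>y\<in>insert b A. y \<le> (f(b := M)) y" using f M bA by auto
  ultimately show ?case by blast
qed

lemma card_diagram_row: "card {j. 1 \<le> j \<and> int j \<le> z} = nat z"
proof -
  have "{j. 1 \<le> j \<and> int j \<le> z} = {1..nat z}" by auto
  then show ?thesis by simp
qed

text \<open>Rows of equal parity use columns of equal parity, and parts weakly decrease, so every
  column of row i + 2 occurs in row i as well.\<close>

lemma row_overlap_eq:
  assumes \<alpha>: "is_partition n \<alpha>" and \<beta>: "is_partition n \<beta>" and i: "1 \<le> i"
  shows "int (row_overlap \<alpha> \<beta> i) = interleaved_content \<alpha> \<beta> (i + 2)"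
proof -
  have nonneg: "0 \<le> x j" if x: "is_partition n x" and "1 \<le> j" for x j
  proof (cases "j \<le> n")
    case True
    then have "x n \<le> x j" "x n = 0" using that unfolding is_partition_def by blast+
    then show ?thesis by simp
  next
    case False
    then show ?thesis using x unfolding is_partition_def int_vector_def by simp
  qed
  have mono: "x (Suc j) \<le> x j" if x: "is_partition n x" and "1 \<le> j" for x j
  proof (cases "Suc j \<le> n")
    case True
    then show ?thesis using that unfolding is_partition_def by auto
  next
    case False
    then have "x (Suc j) = 0" using x unfolding is_partition_def int_vector_def by simp
    then show ?thesis using nonneg[OF that] by simp
  qed
  show ?thesis
  proof (cases "odd i")
    case True
    then obtain q where q: "i = 2 * q + 1" by (rule oddE)
    have "{c. (i, c) \<in> shuffle_diagram \<alpha> \<beta> \<and> (i + 2, c) \<in> shuffle_diagram \<alpha> \<beta>}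
      = (\<lambda>j. 2 * j - 1) ` {j. 1 \<le> j \<and> int j \<le> \<alpha> (q + 2)}" (is "?L = ?R")
    proof (intro equalityI subsetI)
      fix c assume "c \<in> ?L"
      then have "(i + 2, c) \<in> shuffle_diagram \<alpha> \<beta>" by blast
      moreover have "i + 2 \<noteq> 2 * p" for p using q by presburger
      ultimately obtain p j where pj: "i + 2 = 2 * p - 1" "c = 2 * j - 1" "(p, j) \<in> diagram \<alpha>"
        unfolding shuffle_diagram_def by auto
      then have "p = q + 2" using q by (auto simp: diagram_def)
      then show "c \<in> ?R" using pj by (auto simp: diagram_def)
    next
      fix c assume "c \<in> ?R"
      then obtain j where j: "c = 2 * j - 1" "1 \<le> j" "int j \<le> \<alpha> (q + 2)" by auto
      then have "int j \<le> \<alpha> (q + 1)" using mono[OF \<alpha>, of "q + 1"] by simp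
      then have "(q + 1, j) \<in> diagram \<alpha>" "(q + 2, j) \<in> diagram \<alpha>" using j by (auto simp: diagram_def)
      moreover have "i = 2 * (q + 1) - 1" "i + 2 = 2 * (q + 2) - 1" using q by auto
      ultimately show "c \<in> ?L" using j(1) unfolding shuffle_diagram_def by blast
    qed
    moreover have "inj_on (\<lambda>j. 2 * j - 1 :: nat) {j. 1 \<le> j \<and> int j \<le> \<alpha> (q + 2)}"
      by (rule inj_onI) auto
    ultimately have "row_overlap \<alpha> \<beta> i = nat (\<alpha> (q + 2))"
      unfolding row_overlap_def by (simp add: card_image card_diagram_row[simplified])
    moreover have "(i + 2 + 1) div 2 = q + 2" using q by simp
    ultimately show ?thesis
      using True nonneg[OF \<alpha>, of "q + 2"] by (simp add: interleaved_content_def)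
  next
    case False
    then obtain q where q: "i = 2 * q" by auto
    have "{c. (i, c) \<in> shuffle_diagram \<alpha> \<beta> \<and> (i + 2, c) \<in> shuffle_diagram \<alpha> \<beta>}
      = (\<lambda>j. 2 * j) ` {j. 1 \<le> j \<and> int j \<le> \<beta> (q + 1)}" (is "?L = ?R")
    proof (intro equalityI subsetI)
      fix c assume "c \<in> ?L"
      then have "(i + 2, c) \<in> shuffle_diagram \<alpha> \<beta>" by blast
      moreover have "i + 2 \<noteq> 2 * p - 1" for p using q by presburger
      ultimately obtain p j where pj: "i + 2 = 2 * p" "c = 2 * j" "(p, j) \<in> diagram \<beta>"
        unfolding shuffle_diagram_def by auto
      then have "p = q + 1" using q by simp
      then show "c \<in> ?R" using pj by (auto simp: diagram_def)
    next
      fix c assume "c \<in> ?R"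
      then obtain j where j: "c = 2 * j" "1 \<le> j" "int j \<le> \<beta> (q + 1)" by auto
      then have "int j \<le> \<beta> q" using mono[OF \<beta>, of q] q i by simp
      then have "(q, j) \<in> diagram \<beta>" "(q + 1, j) \<in> diagram \<beta>" using j q i by (auto simp: diagram_def)
      moreover have "i + 2 = 2 * (q + 1)" using q by simp
      ultimately show "c \<in> ?L" using j(1) q unfolding shuffle_diagram_def by blast
    qed
    moreover have "inj_on (\<lambda>j. 2 * j :: nat) {j. 1 \<le> j \<and> int j \<le> \<beta> (q + 1)}"
      by (rule inj_onI) auto
    ultimately have "row_overlap \<alpha> \<beta> i = nat (\<beta> (q + 1))"
      unfolding row_overlap_def by (simp add: card_image card_diagram_row[simplified])
    moreover have "(i + 2) div 2 = q + 1" using q by simp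
    ultimately show ?thesis
      using False nonneg[OF \<beta>, of "q + 1"] by (simp add: interleaved_content_def)
  qed
qed

lemma card_squares_with_tab: "1 \<le> v \<Longrightarrow> card (squares_with (tab C) v) = card (C v)"
  unfolding squares_with_tab by (rule card_image) (auto intro: inj_onI)

text \<open>So many disjoint pairs use up every letter v + 2. Counting the pairs whose second square
  lies weakly East of c then bounds one tail by the other.\<close>

lemma matching_imp_dominates:
  assumes C: "valid C" and v: "1 \<le> v"
    and M: "finite M" "card (C (v + 2)) \<le> card M"
      "M \<subseteq> squares_with (tab C) v \<times> squares_with (tab C) (v + 2)"
      "\<forall>(p, q) \<in> M. fst p \<le> fst q \<and> snd q \<le> snd p"
      "pairwise (\<lambda>(p, q) (p', q'). {p, q} \<inter> {p', q'} = {}) M"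
  shows "dominates (C v) (C (v + 2))"
  unfolding dominates_def
proof
  fix c
  have fin: "finite (C v)" "finite (C (v + 2))" using valid_finite[OF C] v by auto
  have M_sub: "\<exists>x y. e = ((ht C v x, x), (ht C (v + 2) y, y)) \<and> x \<in> C v \<and> y \<in> C (v + 2) \<and> y \<le> x"
    if "e \<in> M" for e
  proof -
    have "e \<in> squares_with (tab C) v \<times> squares_with (tab C) (v + 2)" using M that by blast
    then obtain x y where "e = ((ht C v x, x), (ht C (v + 2) y, y))" "x \<in> C v" "y \<in> C (v + 2)"
      using squares_with_tab[of v C] squares_with_tab[of "v + 2" C] v by auto
    moreover have "y \<le> x" using M(4) that calculation by fastforce
    ultimately show ?thesis by blast
  qed
  have inj1: "inj_on (snd \<circ> fst) M" and inj2: "inj_on (snd \<circ> snd) M"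
  proof -
    have disj: "{fst e, snd e} \<inter> {fst e', snd e'} = {}" if "e \<in> M" "e' \<in> M" "e \<noteq> e'" for e e'
      using M(5) that by (fastforce simp: pairwise_def)
    show "inj_on (snd \<circ> fst) M"
    proof (rule inj_onI)
      fix e e' assume e: "e \<in> M" "e' \<in> M" "(snd \<circ> fst) e = (snd \<circ> fst) e'"
      then have "fst e = fst e'" using M_sub[of e] M_sub[of e'] by force
      then show "e = e'" using disj[of e e'] e by blast
    qed
    show "inj_on (snd \<circ> snd) M"
    proof (rule inj_onI)
      fix e e' assume e: "e \<in> M" "e' \<in> M" "(snd \<circ> snd) e = (snd \<circ> snd) e'"
      then have "snd e = snd e'" using M_sub[of e] M_sub[of e'] by force
      then show "e = e'" using disj[of e e'] e by blast
    qed
  qed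
  have "(snd \<circ> snd) ` M \<subseteq> C (v + 2)" using M_sub by fastforce
  moreover have "card ((snd \<circ> snd) ` M) = card M" using inj2 by (rule card_image)
  ultimately have img: "(snd \<circ> snd) ` M = C (v + 2)"
    using M(2) fin by (intro card_seteq) auto
  define M' where "M' = {e \<in> M. c \<le> snd (snd e)}"
  have "{y \<in> C (v + 2). c \<le> y} = (snd \<circ> snd) ` M'"
    unfolding M'_def img[symmetric] by auto
  then have "tail (C (v + 2)) c = card M'"
    unfolding tail_def using card_image[of "snd \<circ> snd" M'] inj2 by (auto simp: M'_def intro: inj_on_subset)
  also have "\<dots> = card ((snd \<circ> fst) ` M')"
    by (rule card_image[symmetric], rule inj_on_subset[OF inj1]) (auto simp: M'_def)
  also have "\<dots> \<le> tail (C v) c"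
    unfolding tail_def
  proof (rule card_mono)
    show "(snd \<circ> fst) ` M' \<subseteq> {x \<in> C v. c \<le> x}"
      unfolding M'_def using M_sub by fastforce
  qed (use fin in auto)
  finally show "tail (C (v + 2)) c \<le> tail (C v) c" .
qed

text \<open>Only columns have to be matched. The row condition is automatic: moving East from y to
  \<open>f y\<close> does not increase the height for v, and heights grow with the letter.\<close>

lemma dominates_imp_matching:
  assumes C: "valid C" and v: "1 \<le> v" and dom: "dominates (C v) (C (v + 2))"
  shows "\<exists>M. finite M \<and> card M = card (C (v + 2)) \<and>
        M \<subseteq> squares_with (tab C) v \<times> squares_with (tab C) (v + 2) \<and>
        (\<forall>(p, q) \<in> M. fst p \<le> fst q \<and> snd q \<le> snd p) \<and>
        pairwise (\<lambda>(p, q) (p', q'). {p, q} \<inter> {p', q'} = {}) M"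
proof -
  have fin: "finite (C v)" "finite (C (v + 2))" using valid_finite[OF C] v by auto
  obtain f where f: "inj_on f (C (v + 2))" "f ` C (v + 2) \<subseteq> C v" "\<forall>y\<in>C (v + 2). y \<le> f y"
    using dominates_inj[OF fin(2,1) dom] by blast
  define g where "g y = ((ht C v (f y), f y), (ht C (v + 2) y, y))" for y
  define M where "M = g ` C (v + 2)"
  have "card M = card (C (v + 2))"
    unfolding M_def by (rule card_image) (auto simp: g_def intro: inj_onI)
  moreover have "M \<subseteq> squares_with (tab C) v \<times> squares_with (tab C) (v + 2)"
    using squares_with_tab[of v C] squares_with_tab[of "v + 2" C] v f by (auto simp: M_def g_def)
  moreover have "fst p \<le> fst q \<and> snd q \<le> snd p" if "(p, q) \<in> M" for p q
  proof -
    obtain y where "y \<in> C (v + 2)" "(p, q) = g y"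
      using \<open>(p, q) \<in> M\<close> unfolding M_def by blast
    then have y: "y \<in> C (v + 2)" "p = (ht C v (f y), f y)" "q = (ht C (v + 2) y, y)"
      by (simp_all only: g_def prod.inject)
    have "ht C v (f y) \<le> ht C v y"
      using valid_antimono[OF C, of y "f y" v] valid_pos[OF C, of "v + 2" y] y f by simp
    also have "\<dots> \<le> ht C (v + 2) y" by (rule ht_mono) simp
    finally show ?thesis using y f by simp
  qed
  moreover have "pairwise (\<lambda>(p, q) (p', q'). {p, q} \<inter> {p', q'} = {}) M"
  proof -
    have disj: "(ht C v x, x) \<noteq> (ht C (v + 2) y, y)" if "y \<in> C (v + 2)" for x y
      using ht_less[of v "v + 2" y C] that by auto
    have "{(ht C v (f y), f y), (ht C (v + 2) y, y)} \<inter> {(ht C v (f z), f z), (ht C (v + 2) z, z)} = {}"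
      if "y \<in> C (v + 2)" "z \<in> C (v + 2)" "y \<noteq> z" for y z
      using disj[OF that(1)] disj[OF that(2)] that f(1) by (auto simp: inj_on_def)
    then show ?thesis unfolding pairwise_def M_def g_def by auto
  qed
  moreover have "finite M" using fin by (simp add: M_def)
  ultimately show ?thesis by blast
qed

lemma peelable_tab:
  assumes C: "valid C" and \<alpha>: "is_partition n \<alpha>" and \<beta>: "is_partition n \<beta>"
  shows "peelable \<alpha> \<beta> (tab C) \<longleftrightarrow>
    (\<forall>v\<ge>1. int (card (C v)) = interleaved_content \<alpha> \<beta> v) \<and> (\<forall>v\<ge>1. dominates (C v) (C (v + 2)))"
    (is "_ \<longleftrightarrow> ?content \<and> ?dom")
proof -
  have eq: "row_overlap \<alpha> \<beta> v = card (C (v + 2))" if ?content "1 \<le> v" for v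
    using row_overlap_eq[OF \<alpha> \<beta> that(2)] that(1)[rule_format, of "v + 2"] by simp
  have content: "(\<forall>v\<ge>1. int (card (squares_with (tab C) v)) = interleaved_content \<alpha> \<beta> v) \<longleftrightarrow> ?content"
    using card_squares_with_tab by auto
  show ?thesis
    unfolding peelable_def content
  proof (intro iffI conjI; (elim conjE)?)
    assume ct: ?content and ex: "\<forall>i\<ge>1. \<exists>M. finite M \<and> row_overlap \<alpha> \<beta> i \<le> card M \<and>
        M \<subseteq> squares_with (tab C) i \<times> squares_with (tab C) (i + 2) \<and>
        (\<forall>(p, q) \<in> M. fst p \<le> fst q \<and> snd q \<le> snd p) \<and>
        pairwise (\<lambda>(p, q) (p', q'). {p, q} \<inter> {p', q'} = {}) M"
    show ?content by (rule ct)
    show ?dom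
    proof (intro allI impI)
      fix v :: nat assume v: "1 \<le> v"
      then obtain M where "finite M" "row_overlap \<alpha> \<beta> v \<le> card M"
        "M \<subseteq> squares_with (tab C) v \<times> squares_with (tab C) (v + 2)"
        "\<forall>(p, q) \<in> M. fst p \<le> fst q \<and> snd q \<le> snd p"
        "pairwise (\<lambda>(p, q) (p', q'). {p, q} \<inter> {p', q'} = {}) M" using ex by blast
      then show "dominates (C v) (C (v + 2))"
        using matching_imp_dominates[OF C v, of M] eq[OF ct v] by simp
    qed
  next
    assume ct: ?content and dom: ?dom
    show "\<forall>i\<ge>1. \<exists>M. finite M \<and> row_overlap \<alpha> \<beta> i \<le> card M \<and>
        M \<subseteq> squares_with (tab C) i \<times> squares_with (tab C) (i + 2) \<and>
        (\<forall>(p, q) \<in> M. fst p \<le> fst q \<and> snd q \<le> snd p) \<and>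
        pairwise (\<lambda>(p, q) (p', q'). {p, q} \<inter> {p', q'} = {}) M"
    proof (intro allI impI)
      fix i :: nat assume i: "1 \<le> i"
      obtain M where M: "finite M" "card M = card (C (i + 2))"
        "M \<subseteq> squares_with (tab C) i \<times> squares_with (tab C) (i + 2)"
        "\<forall>(p, q) \<in> M. fst p \<le> fst q \<and> snd q \<le> snd p"
        "pairwise (\<lambda>(p, q) (p', q'). {p, q} \<inter> {p', q'} = {}) M"
        using dominates_imp_matching[OF C i] dom i by blast
      then show "\<exists>M. finite M \<and> row_overlap \<alpha> \<beta> i \<le> card M \<and>
        M \<subseteq> squares_with (tab C) i \<times> squares_with (tab C) (i + 2) \<and>
        (\<forall>(p, q) \<in> M. fst p \<le> fst q \<and> snd q \<le> snd p) \<and>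
        pairwise (\<lambda>(p, q) (p', q'). {p, q} \<inter> {p', q'} = {}) M"
        using eq[OF ct i] by (intro exI[of _ M]) simp
    qed
  qed (use semistandard_tab[OF C] in auto)
qed

section \<open>The steps of the procedure in terms of column sets\<close>

lemma ht_odd: "1 \<le> j \<Longrightarrow> ht C (2 * j - 1) c = ht C (2 * (j - 1)) c + of_bool (c \<in> C (2 * j - 1))"
  by (cases j) auto

lemma ht_even: "1 \<le> j \<Longrightarrow> ht C (2 * j) c = ht C (2 * j - 1) c + of_bool (c \<in> C (2 * j))"
  by (cases j) auto

text \<open>Rightmost in its row means an outer corner of the shape of the letters up to 2j - 1: if
  the next column had the same height, then, its height for 2j - 2 being no larger than in column c,
  it would hold a 2j - 1 in the same row.\<close>

lemma changeable_odd:
  assumes C: "valid C" and j: "1 \<le> j" and c: "c \<in> C (2 * j - 1)"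
  shows "changeable (tab C) (ht C (2 * j - 1) c, c) \<longleftrightarrow>
    c \<notin> C (2 * j) \<and> ht C (2 * j - 1) (Suc c) < ht C (2 * j - 1) c"
proof -
  let ?h = "ht C (2 * j - 1)"
  have c1: "1 \<le> c" using valid_pos[OF C _ c] j by auto
  have val: "tab C (?h c, c) = Some (2 * j - 1)" using c j by (auto simp: tab_eq_Some)
  have "changeable (tab C) (?h c, c) \<longleftrightarrow>
    (\<forall>c'. tab C (?h c, c') = Some (2 * j - 1) \<longrightarrow> c' \<le> c) \<and> tab C (?h c + 1, c) \<noteq> Some (2 * j)"
  proof -
    have ne: "2 * j - 1 \<noteq> 2 * i" if "1 \<le> i" for i using that j by presburger
    have eq: "i = j" if "1 \<le> i" "2 * j - 1 = 2 * i - 1" for i using that j by linarith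
    show ?thesis unfolding changeable_def prod.case val option.inject using j ne eq by metis
  qed
  also have "tab C (?h c + 1, c) = Some (2 * j) \<longleftrightarrow> c \<in> C (2 * j)"
    using ht_even[OF j, of C c] j by (auto simp: tab_eq_Some)
  also have "(\<forall>c'. tab C (?h c, c') = Some (2 * j - 1) \<longrightarrow> c' \<le> c) \<longleftrightarrow> ?h (Suc c) < ?h c"
  proof
    assume max: "\<forall>c'. tab C (?h c, c') = Some (2 * j - 1) \<longrightarrow> c' \<le> c"
    show "?h (Suc c) < ?h c"
    proof (rule ccontr)
      assume "\<not> ?h (Suc c) < ?h c"
      moreover have "?h (Suc c) \<le> ?h c" "ht C (2 * (j - 1)) (Suc c) \<le> ht C (2 * (j - 1)) c"
        using valid_antimono[OF C c1] by auto
      ultimately have "?h (Suc c) = ?h c" "Suc c \<in> C (2 * j - 1)"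
        using ht_odd[OF j, of C c] ht_odd[OF j, of C "Suc c"] c by (cases "Suc c \<in> C (2 * j - 1)"; simp)+
      then have "tab C (?h c, Suc c) = Some (2 * j - 1)" using j by (auto simp: tab_eq_Some)
      then show False using max by fastforce
    qed
  next
    assume less: "?h (Suc c) < ?h c"
    show "\<forall>c'. tab C (?h c, c') = Some (2 * j - 1) \<longrightarrow> c' \<le> c"
    proof (intro allI impI)
      fix c' assume "tab C (?h c, c') = Some (2 * j - 1)"
      then have "?h c' = ?h c" by (auto simp: tab_eq_Some)
      then show "c' \<le> c" using valid_antimono[OF C, of "Suc c" c' "2 * j - 1"] less
        by (metis Suc_leI le_add1 leD linorder_not_le plus_1_eq_Suc)
    qed
  qed
  finally show ?thesis by auto
qed

text \<open>Leftmost in its row means that the left neighbour, if any, is smaller than 2j, that is,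
  the height for 2j - 1 drops on entering column c. Column 1 is separate since column 0 is outside
  the diagram.\<close>

lemma changeable_even:
  assumes C: "valid C" and j: "1 \<le> j" and c: "c \<in> C (2 * j)"
  shows "changeable (tab C) (ht C (2 * j) c, c) \<longleftrightarrow>
    c \<notin> C (2 * j - 1) \<and> (c = 1 \<or> ht C (2 * j - 1) c < ht C (2 * j - 1) (c - 1))"
proof -
  let ?h = "ht C (2 * j)" and ?g = "ht C (2 * j - 1)"
  have c1: "1 \<le> c" using valid_pos[OF C _ c] j by auto
  have val: "tab C (?h c, c) = Some (2 * j)" using c j by (auto simp: tab_eq_Some)
  have "changeable (tab C) (?h c, c) \<longleftrightarrow>
    (\<forall>c'. tab C (?h c, c') = Some (2 * j) \<longrightarrow> c \<le> c') \<and> tab C (?h c - 1, c) \<noteq> Some (2 * j - 1)"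
  proof -
    have ne: "2 * j \<noteq> 2 * i - 1" if "1 \<le> i" for i using that j by presburger
    have eq: "i = j" if "2 * j = 2 * i" for i using that by linarith
    show ?thesis unfolding changeable_def prod.case val option.inject using j ne eq by metis
  qed
  also have "tab C (?h c - 1, c) = Some (2 * j - 1) \<longleftrightarrow> c \<in> C (2 * j - 1)"
    using ht_even[OF j, of C c] j c by (auto simp: tab_eq_Some)
  also have "(\<forall>c'. tab C (?h c, c') = Some (2 * j) \<longrightarrow> c \<le> c') \<longleftrightarrow> c = 1 \<or> ?g c < ?g (c - 1)"
  proof
    assume min: "\<forall>c'. tab C (?h c, c') = Some (2 * j) \<longrightarrow> c \<le> c'"
    show "c = 1 \<or> ?g c < ?g (c - 1)"
    proof (rule ccontr)
      assume neg: "\<not> (c = 1 \<or> ?g c < ?g (c - 1))"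
      then have c2: "1 \<le> c - 1" using c1 by linarith
      have "?g c \<le> ?g (c - 1)" "?h c \<le> ?h (c - 1)"
        using valid_antimono[OF C c2, of c] by auto
      then have "?h (c - 1) = ?h c" "c - 1 \<in> C (2 * j)"
        using neg ht_even[OF j, of C c] ht_even[OF j, of C "c - 1"] c by (cases "c - 1 \<in> C (2 * j)"; simp)+
      then have "tab C (?h c, c - 1) = Some (2 * j)" using j by (auto simp: tab_eq_Some)
      then have "c \<le> c - 1" using min by blast
      then show False using c2 by linarith
    qed
  next
    assume less: "c = 1 \<or> ?g c < ?g (c - 1)"
    show "\<forall>c'. tab C (?h c, c') = Some (2 * j) \<longrightarrow> c \<le> c'"
    proof (intro allI impI)
      fix c' assume "tab C (?h c, c') = Some (2 * j)"
      then have c': "c' \<in> C (2 * j)" "?h c' = ?h c" by (auto simp: tab_eq_Some)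
      have pos: "1 \<le> c'" using valid_pos[OF C _ c'(1)] j by auto
      have eq: "?g c' = ?g c" using c' c ht_even[OF j, of C c] ht_even[OF j, of C c'] by auto
      show "c \<le> c'"
      proof (rule ccontr)
        assume "\<not> c \<le> c'"
        then have "c' \<le> c - 1" "c \<noteq> 1" using pos by auto
        then have "?g (c - 1) \<le> ?g c'" "?g c < ?g (c - 1)" using valid_antimono[OF C pos] less by auto
        then show False using eq by simp
      qed
    qed
  qed
  finally show ?thesis by auto
qed

lemma the_square_eq: "(\<And>q'. q' \<in> S \<longleftrightarrow> q' = q) \<Longrightarrow> the_square S = Some q"
  unfolding the_square_def by auto

lemma leftmost_eq:
  assumes "q \<in> S" "\<And>q'. q' \<in> S \<Longrightarrow> q' \<noteq> q \<Longrightarrow> snd q < snd q'"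
  shows "leftmost S = Some q"
proof -
  have "q' \<in> {q \<in> S. \<forall>q' \<in> S. snd q \<le> snd q'} \<longleftrightarrow> q' = q" for q'
    using assms by (smt (verit) leD less_imp_le mem_Collect_eq order_refl)
  then show ?thesis unfolding leftmost_def by (rule the_square_eq)
qed

lemma rightmost_eq:
  assumes "q \<in> S" "\<And>q'. q' \<in> S \<Longrightarrow> q' \<noteq> q \<Longrightarrow> snd q' < snd q"
  shows "rightmost S = Some q"
proof -
  have "q' \<in> {q \<in> S. \<forall>q' \<in> S. snd q' \<le> snd q} \<longleftrightarrow> q' = q" for q'
    using assms by (smt (verit) leD less_imp_le mem_Collect_eq order_refl)
  then show ?thesis unfolding rightmost_def by (rule the_square_eq)
qed

lemma raise_step_tab:
  assumes C: "valid C" and j: "1 \<le> j"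
    and s: "s \<in> C (2 * j - 1)" "s \<notin> C (2 * j)" "ht C (2 * j - 1) (Suc s) < ht C (2 * j - 1) s" "c0 \<le> s"
    and min: "\<And>c. c \<in> C (2 * j - 1) \<Longrightarrow> c \<notin> C (2 * j) \<Longrightarrow>
      ht C (2 * j - 1) (Suc c) < ht C (2 * j - 1) c \<Longrightarrow> c0 \<le> c \<Longrightarrow> s \<le> c"
  shows "raise_step j (tab C, c0) =
    Some (tab (C(2 * j - 1 := C (2 * j - 1) - {s}, 2 * j := insert s (C (2 * j)))), s)"
proof -
  let ?h = "ht C (2 * j - 1)"
  have sq: "squares_with (tab C) (2 * j - 1) = (\<lambda>c. (?h c, c)) ` C (2 * j - 1)"
    using j by (intro squares_with_tab) auto
  have "leftmost {q \<in> squares_with (tab C) (2 * j - 1). changeable (tab C) q \<and> c0 \<le> snd q} = Some (?h s, s)"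
  proof (rule leftmost_eq)
    show "(?h s, s) \<in> {q \<in> squares_with (tab C) (2 * j - 1). changeable (tab C) q \<and> c0 \<le> snd q}"
      unfolding sq using s changeable_odd[OF C j s(1)] by auto
  next
    fix q assume q: "q \<in> {q \<in> squares_with (tab C) (2 * j - 1). changeable (tab C) q \<and> c0 \<le> snd q}"
      "q \<noteq> (?h s, s)"
    then obtain c where c: "c \<in> C (2 * j - 1)" "q = (?h c, c)" unfolding sq by auto
    then have "s \<le> c" using q changeable_odd[OF C j c(1)] by (intro min) auto
    moreover have "c \<noteq> s" using c q by auto
    ultimately show "snd (?h s, s) < snd q" using c by simp
  qed
  moreover have "(tab C)((?h s, s) \<mapsto> 2 * j) =
    tab (C(2 * j - 1 := C (2 * j - 1) - {s}, 2 * j := insert s (C (2 * j))))"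
  proof -
    have "Suc (2 * j - 1) = 2 * j" using j by simp
    then show ?thesis using tab_raise[of "2 * j - 1" s C, OF _ s(1) _ refl] s(2) j by simp
  qed
  ultimately show ?thesis by (simp add: raise_step_def)
qed

lemma swap_step_tab:
  assumes C: "valid C" and j: "1 \<le> j"
    and x: "C (2 * j - 1) = {x}" "x \<notin> C (2 * j)"
    and t: "t \<in> C (2 * j)" "t = 1 \<or> ht C (2 * j - 1) t < ht C (2 * j - 1) (t - 1)"
    and max: "\<And>c. c \<in> C (2 * j) \<Longrightarrow> c = 1 \<or> ht C (2 * j - 1) c < ht C (2 * j - 1) (c - 1) \<Longrightarrow> c \<le> t"
  shows "swap_step j (tab C) =
    Some (tab (C(2 * j - 1 := {t}, 2 * j := insert x (C (2 * j) - {t}))))"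
proof -
  let ?h = "ht C (2 * j)" and ?g = "ht C (2 * j - 1)"
  have tx: "t \<noteq> x" using t x by auto
  have sq1: "squares_with (tab C) (2 * j - 1) = {(?g x, x)}"
    using j squares_with_tab[of "2 * j - 1" C] x by simp
  have sq2: "squares_with (tab C) (2 * j) = (\<lambda>c. (?h c, c)) ` C (2 * j)"
    using j by (intro squares_with_tab) auto
  have "the_square (squares_with (tab C) (2 * j - 1)) = Some (?g x, x)"
    unfolding sq1 by (rule the_square_eq) simp
  moreover have "rightmost {q \<in> squares_with (tab C) (2 * j). changeable (tab C) q} = Some (?h t, t)"
  proof (rule rightmost_eq)
    show "(?h t, t) \<in> {q \<in> squares_with (tab C) (2 * j). changeable (tab C) q}"
      unfolding sq2 using t tx x changeable_even[OF C j t(1)] by auto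
  next
    fix q assume q: "q \<in> {q \<in> squares_with (tab C) (2 * j). changeable (tab C) q}" "q \<noteq> (?h t, t)"
    then obtain c where c: "c \<in> C (2 * j)" "q = (?h c, c)" unfolding sq2 by auto
    then have "c \<le> t" using q changeable_even[OF C j c(1)] by (intro max) auto
    moreover have "c \<noteq> t" using c q by auto
    ultimately show "snd q < snd (?h t, t)" using c by simp
  qed
  moreover have "(tab C)((?g x, x) \<mapsto> 2 * j, (?h t, t) \<mapsto> 2 * j - 1) =
    tab (C(2 * j - 1 := {t}, 2 * j := insert x (C (2 * j) - {t})))"
  proof -
    have Suc: "Suc (2 * j - 1) = 2 * j" and ne: "2 * j - 1 \<noteq> 2 * j" using j by auto
    \<comment> \<open>Both squares are selected in the original tableau, but the changes are made
      one after the other. As t and x are different columns, the first change leaves the row of t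
      intact.\<close>
    define D where "D = C(2 * j - 1 := C (2 * j - 1) - {x}, 2 * j := insert x (C (2 * j)))"
    have 1: "(tab C)((?g x, x) \<mapsto> 2 * j) = tab D"
      using tab_raise[of "2 * j - 1" x C D] j x unfolding Suc D_def by auto
    have "ht D w t = ht C w t" for w
      using tx by (induction w) (auto simp: D_def)
    moreover have "(tab D)((ht D (2 * j) t, t) \<mapsto> 2 * j - 1) =
      tab (D(2 * j - 1 := insert t (D (2 * j - 1)), 2 * j := D (2 * j) - {t}))"
      using tab_lower[of "2 * j - 1" t D, OF _ _ _ refl] j tx x t(1) ne unfolding Suc by (auto simp: D_def)
    moreover have "D(2 * j - 1 := insert t (D (2 * j - 1)), 2 * j := D (2 * j) - {t})
      = C(2 * j - 1 := {t}, 2 * j := insert x (C (2 * j) - {t}))"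
      using tx x ne by (auto simp: D_def fun_eq_iff)
    ultimately show ?thesis unfolding 1 by simp
  qed
  ultimately show ?thesis by (simp add: swap_step_def)
qed

section \<open>Exchanges within the pairs of letters 2j - 1, 2j\<close>

definition exch :: "(nat \<Rightarrow> nat set) \<Rightarrow> (nat \<Rightarrow> nat set) \<Rightarrow> (nat \<Rightarrow> nat set) \<Rightarrow> nat \<Rightarrow> nat set" where
  "exch C P Q v =
     (if odd v then C v - P ((v + 1) div 2) \<union> Q ((v + 1) div 2) else C v - Q (v div 2) \<union> P (v div 2))"

definition exchangeable :: "(nat \<Rightarrow> nat set) \<Rightarrow> (nat \<Rightarrow> nat set) \<Rightarrow> (nat \<Rightarrow> nat set) \<Rightarrow> bool" where
  "exchangeable C P Q \<longleftrightarrow>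
     (\<forall>j\<ge>1. P j \<subseteq> C (2 * j - 1) - C (2 * j) \<and> Q j \<subseteq> C (2 * j) - C (2 * j - 1))"

lemma exch_odd: "1 \<le> j \<Longrightarrow> exch C P Q (2 * j - 1) = C (2 * j - 1) - P j \<union> Q j"
proof -
  assume "1 \<le> j"
  then have "odd (2 * j - 1)" "(2 * j - 1 + 1) div 2 = j" by auto
  then show ?thesis unfolding exch_def by presburger
qed

lemma exch_even: "exch C P Q (2 * j) = C (2 * j) - Q j \<union> P j"
  by (simp add: exch_def)

lemma letter_cases:
  fixes v :: nat
  assumes "1 \<le> v"
  obtains j where "1 \<le> j" "v = 2 * j - 1" | j where "1 \<le> j" "v = 2 * j"
  using assms that(1)[of "(v + 1) div 2"] that(2)[of "v div 2"] by (cases "odd v") (auto elim!: oddE evenE)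

text \<open>An exchanged column holds exactly one of the two letters before and after, so the count
  up to 2j is unaffected. Only heights at odd letters can spoil validity.\<close>

lemma ht_exch_even: "exchangeable C P Q \<Longrightarrow> ht (exch C P Q) (2 * j) c = ht C (2 * j) c"
proof (induction j)
  case (Suc j)
  have "P (Suc j) \<subseteq> C (2 * j + 1) - C (2 * j + 2)" "Q (Suc j) \<subseteq> C (2 * j + 2) - C (2 * j + 1)"
    using Suc.prems unfolding exchangeable_def by (auto dest!: spec[of _ "Suc j"])
  then show ?case using Suc by (auto simp: exch_def)
qed simp

lemma ht_exch_odd:
  assumes "exchangeable C P Q" "1 \<le> j"
  shows "ht (exch C P Q) (2 * j - 1) c + of_bool (c \<in> P j) = ht C (2 * j - 1) c + of_bool (c \<in> Q j)"
proof -
  have "P j \<subseteq> C (2 * j - 1)" "Q j \<inter> C (2 * j - 1) = {}"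
    using assms unfolding exchangeable_def by auto
  then show ?thesis
    unfolding ht_odd[OF assms(2)] ht_exch_even[OF assms(1)] exch_odd[OF assms(2)] by auto
qed

lemma valid_exch:
  assumes C: "valid C" and ex: "exchangeable C P Q"
    and anti: "\<And>j c. 1 \<le> j \<Longrightarrow> 1 \<le> c \<Longrightarrow>
      ht (exch C P Q) (2 * j - 1) (Suc c) \<le> ht (exch C P Q) (2 * j - 1) c"
  shows "valid (exch C P Q)"
proof -
  have sub: "exch C P Q v \<subseteq> C v \<union> (if odd v then C (v + 1) else C (v - 1))" if "1 \<le> v" for v
    using that
  proof (cases rule: letter_cases)
    case (1 j)
    then have "odd v" "v + 1 = 2 * j" by auto
    moreover have "Q j \<subseteq> C (2 * j)" using ex 1 unfolding exchangeable_def by auto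
    ultimately show ?thesis using exch_odd[OF 1(1), of C P Q] 1 by auto
  next
    case (2 j)
    moreover have "P j \<subseteq> C (2 * j - 1)" using ex 2 unfolding exchangeable_def by auto
    ultimately show ?thesis using exch_even[of C P Q j] by auto
  qed
  have "finite (exch C P Q v) \<and> 0 \<notin> exch C P Q v" if "1 \<le> v" for v
  proof -
    have "finite (C u) \<and> 0 \<notin> C u" if "1 \<le> u" for u using C that unfolding valid_def by blast
    moreover have "1 \<le> (if odd v then v + 1 else v - 1)" using that by (cases "v = 1") auto
    ultimately have "finite (C v \<union> (if odd v then C (v + 1) else C (v - 1))) \<and>
      0 \<notin> C v \<union> (if odd v then C (v + 1) else C (v - 1))" using that by (auto split: if_splits)
    then show ?thesis using sub[OF that] finite_subset by blast
  qed
  moreover have "\<exists>N. \<forall>v>N. exch C P Q v = {}"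
  proof -
    obtain N where N: "\<And>v. N < v \<Longrightarrow> C v = {}" using C unfolding valid_def by auto
    have "exch C P Q v = {}" if "N + 1 < v" for v
      using sub[of v] N[of v] N[of "v + 1"] N[of "v - 1"] that by (auto split: if_splits)
    then show ?thesis by blast
  qed
  moreover have "ht (exch C P Q) v (Suc c) \<le> ht (exch C P Q) v c" if "1 \<le> c" for v c
  proof (cases "v = 0")
    case False
    then have "1 \<le> v" by simp
    then show ?thesis
    proof (cases rule: letter_cases)
      case (1 j)
      then show ?thesis using anti that by simp
    next
      case (2 j)
      then show ?thesis using ht_exch_even[OF ex] valid_antimono[OF C that, of "Suc c"] by simp
    qed
  qed simp
  ultimately show ?thesis unfolding valid_def by blast
qed

section \<open>Raising along the first \<open>k\<close> pairs of letters\<close>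

lemma exch_upd:
  assumes "1 \<le> j"
  shows "(exch C P Q)(2 * j - 1 := C (2 * j - 1) - p \<union> q, 2 * j := C (2 * j) - q \<union> p) =
    exch C (P(j := p)) (Q(j := q))"
proof
  fix v :: nat
  consider "v = 0" | i where "1 \<le> i" "v = 2 * i - 1" | i where "1 \<le> i" "v = 2 * i"
  proof (cases "v = 0")
    case False
    then have "1 \<le> v" by simp
    then show thesis by (cases rule: letter_cases) (use that in blast)+
  qed (use that in blast)
  then show "((exch C P Q)(2 * j - 1 := C (2 * j - 1) - p \<union> q, 2 * j := C (2 * j) - q \<union> p)) v =
    exch C (P(j := p)) (Q(j := q)) v"
  proof cases
    case 1
    then show ?thesis using assms by (simp add: exch_def)
  next
    case (2 i)
    have "2 * i - 1 = 2 * j - 1 \<longleftrightarrow> i = j" "2 * i - 1 \<noteq> 2 * j" using 2 assms by presburger+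
    then show ?thesis unfolding 2(2) exch_odd[OF 2(1)] using exch_odd[OF 2(1), of C P Q] by simp
  next
    case (3 i)
    have "2 * i \<noteq> 2 * j - 1" using assms by presburger
    then show ?thesis unfolding 3(2) exch_even using exch_even[of C P Q i] by simp
  qed
qed

text \<open>Lowering a height is safe where it drops towards the East; increasing one is safe in
  column 1 or after a drop from the West. Together they could clash only for t = s + 1, where one
  drop would have to absorb both changes; t < s excludes this.\<close>

lemma valid_exch_corners:
  assumes C: "valid C" and ex: "exchangeable C P Q"
    and corners: "\<And>j. 1 \<le> j \<Longrightarrow> P j = {} \<and> Q j = {} \<or>
      (\<exists>s. P j = {s} \<and> ht C (2 * j - 1) (Suc s) < ht C (2 * j - 1) s \<and>
         (Q j = {} \<or> (\<exists>t<s. Q j = {t} \<and> (t = 1 \<or> ht C (2 * j - 1) t < ht C (2 * j - 1) (t - 1)))))"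
  shows "valid (exch C P Q)"
proof (rule valid_exch[OF C ex])
  fix j c :: nat
  assume j: "1 \<le> j" and c: "1 \<le> c"
  let ?g = "ht C (2 * j - 1)" and ?g' = "ht (exch C P Q) (2 * j - 1)"
  have eq: "?g' c + of_bool (c \<in> P j) = ?g c + of_bool (c \<in> Q j)" for c
    by (rule ht_exch_odd[OF ex j])
  have anti: "?g (Suc c) \<le> ?g c" using valid_antimono[OF C c] by simp
  from corners[OF j] show "?g' (Suc c) \<le> ?g' c"
  proof (elim disjE exE conjE)
    assume "P j = {}" "Q j = {}"
    then show ?thesis using eq[of c] eq[of "Suc c"] anti by simp
  next
    fix s assume s: "P j = {s}" "Q j = {}" "?g (Suc s) < ?g s"
    then show ?thesis using eq[of c] eq[of "Suc c"] anti by (cases "c = s"; cases "Suc c = s") auto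
  next
    fix s t assume s: "P j = {s}" "?g (Suc s) < ?g s" "t < s" "Q j = {t}" "t = 1"
    then show ?thesis using eq[of c] eq[of "Suc c"] anti c
      by (cases "c = s"; cases "Suc c = s"; cases "c = t") auto
  next
    fix s t assume s: "P j = {s}" "?g (Suc s) < ?g s" "t < s" "Q j = {t}" "?g t < ?g (t - 1)"
    then show ?thesis using eq[of c] eq[of "Suc c"] anti c
      by (cases "c = s"; cases "Suc c = s"; cases "c = t"; cases "Suc c = t") auto
  qed
qed

section \<open>Existence of the squares to be raised\<close>

lemma tail_run:
  assumes "finite X" "c \<le> d" "{c..<d} \<subseteq> X"
  shows "tail X c = tail X d + (d - c)"
  using assms(2,3)
proof (induction d rule: dec_induct)
  case (step e)
  have "{c..<e} \<subseteq> X" "e \<in> X" using step.hyps step.prems by (simp_all add: subset_eq)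
  then show ?case using step.IH step.hyps tail_Suc[OF assms(1), of e] by simp
qed simp

lemma tail_gap:
  assumes "finite X" "c \<le> d" "{c..<d} \<inter> X = {}"
  shows "tail X c = tail X d"
  using assms(2,3)
proof (induction d rule: dec_induct)
  case (step e)
  have "e \<in> {c..<Suc e}" "{c..<e} \<subseteq> {c..<Suc e}" using step.hyps by auto
  then have "{c..<e} \<inter> X = {}" "e \<notin> X" using step.prems by blast+
  then show ?case using step.IH tail_Suc[OF assms(1), of e] by simp
qed simp

lemma tail_le_run:
  assumes "finite X" "c \<le> d"
  shows "tail X c \<le> tail X d + (d - c)"
  using assms(2)
proof (induction d rule: dec_induct)
  case (step e)
  then show ?case using tail_Suc[OF assms(1), of e] by (cases "e \<in> X") auto
qed simp

text \<open>\<open>C (2 * j)\<close> has mu_j elements. The assumptions \<open>small\<close>,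
  \<open>strict\<close> and \<open>nonempty\<close> translate the alcove inequalities for nu at the
  coordinate pairs (m, n), (m - 1, m) and (m, n - 1); \<open>a2\<close> expresses nu_(k+1) <=
  nu_k.\<close>

locale family =
  fixes C :: "nat \<Rightarrow> nat set" and n m k a :: nat
  assumes valid: "valid C" and m: "1 \<le> m" "m \<le> k" "k < n"
    and card_low: "1 \<le> j \<Longrightarrow> j \<le> k \<Longrightarrow> card (C (2 * j - 1)) = a"
    and card_mid: "k < j \<Longrightarrow> j < n \<Longrightarrow> card (C (2 * j - 1)) = 1"
    and high: "n \<le> j \<Longrightarrow> C (2 * j - 1) = {}" "n \<le> j \<Longrightarrow> C (2 * j) = {}"
    and dom: "1 \<le> v \<Longrightarrow> dominates (C v) (C (v + 2))"
    and small: "card (C (2 * m)) < a"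
    and strict: "1 < m \<Longrightarrow> card (C (2 * m)) < card (C (2 * (m - 1)))"
    and a2: "k + 1 < n \<Longrightarrow> 2 \<le> a"
    and nonempty: "card (C (2 * m)) = a - 1 \<Longrightarrow> k + 1 < n \<Longrightarrow> 1 \<le> j \<Longrightarrow> j < n \<Longrightarrow> C (2 * j) \<noteq> {}"
begin

definition A where "A j = C (2 * j - 1)"
definition B where "B j = C (2 * j)"
definition g where "g j = ht C (2 * j - 1)"
definition h where "h j = ht C (2 * j)"

lemma g_eq: "1 \<le> j \<Longrightarrow> g j c = h (j - 1) c + of_bool (c \<in> A j)"
  unfolding g_def h_def A_def by (rule ht_odd)

lemma h_eq: "1 \<le> j \<Longrightarrow> h j c = g j c + of_bool (c \<in> B j)"
  unfolding g_def h_def B_def by (rule ht_even)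

lemma g_antimono: "1 \<le> c \<Longrightarrow> c \<le> d \<Longrightarrow> g j d \<le> g j c"
  and h_antimono: "1 \<le> c \<Longrightarrow> c \<le> d \<Longrightarrow> h j d \<le> h j c"
  unfolding g_def h_def by (rule valid_antimono[OF valid]; assumption)+

lemma finite_A [simp]: "1 \<le> j \<Longrightarrow> finite (A j)" and finite_B [simp]: "1 \<le> j \<Longrightarrow> finite (B j)"
  unfolding A_def B_def by (rule valid_finite[OF valid]; simp)+

lemma B_pos: "1 \<le> j \<Longrightarrow> b \<in> B j \<Longrightarrow> 1 \<le> b"
  unfolding B_def by (rule valid_pos[OF valid]) auto

lemma A_pos: "1 \<le> j \<Longrightarrow> b \<in> A j \<Longrightarrow> 1 \<le> b"
  unfolding A_def by (rule valid_pos[OF valid]) auto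

lemma dom_A: "1 \<le> j \<Longrightarrow> dominates (A j) (A (Suc j))"
  using dom[of "2 * j - 1"] unfolding A_def by (simp add: numeral_2_eq_2 Suc_diff_Suc)

lemma dom_B: "1 \<le> j \<Longrightarrow> dominates (B j) (B (Suc j))"
  using dom[of "2 * j"] unfolding B_def by simp

lemma tail_B_le: "1 \<le> j \<Longrightarrow> tail (B (Suc j)) c \<le> tail (B j) c"
  using dom_B unfolding dominates_def by blast

text \<open>The letters 1 fill an initial part of the first row. Afterwards domination keeps the set
  inside \<open>{1..a}\<close>, and its size leaves no choice.\<close>

lemma A_low: "1 \<le> j \<Longrightarrow> j \<le> k \<Longrightarrow> A j = {1..a}"
proof (induction j rule: dec_induct)
  case base
  have "ht C 1 (Suc c) \<le> ht C 1 c" if "1 \<le> c" for c using valid_antimono[OF valid that, of "Suc c" 1] by simp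
  then have down: "c \<in> C 1" if "Suc c \<in> C 1" "1 \<le> c" for c
    using that by (cases "c \<in> C 1") fastforce+
  have sub: "{1..c} \<subseteq> C 1" if "c \<in> C 1" "1 \<le> c" for c
    using that(2,1)
  proof (induction c rule: dec_induct)
    case (step c)
    then show ?case using down[of c] by (auto simp: le_Suc_eq)
  qed auto
  have "C 1 \<subseteq> {1..a}"
  proof
    fix c assume c: "c \<in> C 1"
    then have c1: "1 \<le> c" using valid_pos[OF valid] by auto
    then have "card {1..c} \<le> card (C 1)" using sub[OF c] valid_finite[OF valid, of 1] by (intro card_mono) auto
    then show "c \<in> {1..a}" using card_low[of 1] c1 m by simp
  qed
  then show ?case using card_low[of 1] m card_subset_eq[of "{1..a}" "C 1"] by (simp add: A_def)
next
  case (step j)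
  have "A (Suc j) \<subseteq> {1..a}"
  proof
    fix c assume c: "c \<in> A (Suc j)"
    have "\<exists>x\<in>A j. c \<le> x" using dominates_ex[OF _ dom_A c] step.hyps by simp
    then show "c \<in> {1..a}" using step A_pos[OF _ c] by fastforce
  qed
  moreover have "card (A (Suc j)) = card {1..a}" using card_low[of "Suc j"] step by (simp add: A_def)
  ultimately show ?case by (intro card_subset_eq) auto
qed

lemma flat:
  assumes "1 \<le> f" "f \<le> x" "x \<le> s" "g j f = g j s"
  shows "g j x = g j s"
  using g_antimono[of f x j] g_antimono[of x s j] assms by linarith

text \<open>The columns \<open>f0\<close> and \<open>s0\<close> belong to the preceding pair of
  letters; \<open>s0 = 0\<close> stands for the first choice. By \<open>room\<close>, the a - f0 + 1
  columns from f0 to a cannot all hold 2j, so there is a first free one, f; the first corner s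
  weakly East of f is the wanted square.\<close>

lemma next_square:
  assumes j: "1 \<le> j" "j \<le> k" and f0: "1 \<le> f0" "f0 \<le> max 1 s0" "s0 \<le> a"
    and flat0: "0 < s0 \<Longrightarrow> h (j - 1) f0 = h (j - 1) s0"
    and room: "tail (B j) f0 + f0 \<le> a"
  obtains f s where "f0 \<le> f" "f \<le> s" "s0 \<le> s" "s \<le> a" "{f0..<f} \<subseteq> B j" "{f..s} \<inter> B j = {}"
    "g j f = g j s" "g j (Suc s) < g j s"
    "\<And>c. c \<in> {1..a} \<Longrightarrow> c \<notin> B j \<Longrightarrow> g j (Suc c) < g j c \<Longrightarrow> s0 \<le> c \<Longrightarrow> s \<le> c"
proof -
  have Aj: "A j = {1..a}" using A_low j by simp
  have ex: "\<exists>f. f0 \<le> f \<and> f \<le> a \<and> f \<notin> B j"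
  proof (rule ccontr)
    assume "\<not> ?thesis"
    then have "{f0..<Suc a} \<subseteq> B j" by (auto simp: less_Suc_eq_le)
    from tail_run[OF _ _ this] have "tail (B j) f0 \<ge> Suc a - f0" using room j by auto
    then show False using room by linarith
  qed
  define f where "f = (LEAST f. f0 \<le> f \<and> f \<le> a \<and> f \<notin> B j)"
  have f: "f0 \<le> f" "f \<le> a" "f \<notin> B j" using LeastI_ex[OF ex] unfolding f_def by auto
  have run: "{f0..<f} \<subseteq> B j"
  proof
    fix x assume x: "x \<in> {f0..<f}"
    then show "x \<in> B j" using not_less_Least[of x "\<lambda>f. f0 \<le> f \<and> f \<le> a \<and> f \<notin> B j"] f
      unfolding f_def[symmetric] by auto
  qed
  have f1: "1 \<le> f" using f f0 by simp
  have "g j (Suc a) < g j a"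
    using g_eq[OF j(1), of a] g_eq[OF j(1), of "Suc a"] h_antimono[of a "Suc a" "j - 1"] f f1 Aj by auto
  then have ex_s: "\<exists>s. f \<le> s \<and> g j (Suc s) < g j s" using f by blast
  define s where "s = (LEAST s. f \<le> s \<and> g j (Suc s) < g j s)"
  have s: "f \<le> s" "g j (Suc s) < g j s" using LeastI_ex[OF ex_s] unfolding s_def by auto
  have s_min: "s \<le> c" if "f \<le> c" "g j (Suc c) < g j c" for c
    unfolding s_def by (rule Least_le) (use that in auto)
  have sa: "s \<le> a" using s_min[OF f(2)] \<open>g j (Suc a) < g j a\<close> by simp
  have flat_s: "g j x = g j f" if "f \<le> x" "x \<le> s" for x
    using that
  proof (induction x rule: dec_induct)
    case (step x)
    then have "\<not> g j (Suc x) < g j x" using s_min[of x] by linarith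
    then show ?case using step g_antimono[of x "Suc x" j] f1 by simp
  qed simp
  \<comment> \<open>At f the heights for 2j - 1 and 2j agree. The former is constant up to s and the
    latter cannot grow, so no 2j fits in between.\<close>
  have gap: "{f..s} \<inter> B j = {}"
  proof -
    have "x \<notin> B j" if "x \<in> {f..s}" for x
      using h_antimono[of f x j] h_eq[OF j(1), of f] h_eq[OF j(1), of x] flat_s[of x] that f f1 by auto
    then show ?thesis by blast
  qed
  \<comment> \<open>The height for 2j - 2 is constant from f0 to s0 and all these columns hold 2j -
    1, so no corner occurs before s0.\<close>
  have s0s: "s0 \<le> s"
  proof (rule ccontr)
    assume neg: "\<not> s0 \<le> s"
    then have "h (j - 1) f0 = h (j - 1) s0" using flat0 by simp
    moreover have "h (j - 1) s0 \<le> h (j - 1) (Suc s)" "h (j - 1) s \<le> h (j - 1) f0"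
      using neg s f f0 by (intro h_antimono; simp)+
    ultimately have "h (j - 1) s \<le> h (j - 1) (Suc s)" by simp
    moreover have "s \<in> A j" "Suc s \<in> A j" using neg f0 s f1 by (auto simp: Aj)
    ultimately show False using s(2) g_eq[OF j(1)] by simp
  qed
  have "s \<le> c" if c: "c \<in> {1..a}" "c \<notin> B j" "g j (Suc c) < g j c" "s0 \<le> c" for c
  proof -
    have "f0 \<le> c" using f0 c by (auto simp: max_def split: if_splits)
    then have "f \<le> c" using run c by (meson atLeastLessThan_iff not_le subsetD)
    then show ?thesis using s_min c by simp
  qed
  then show thesis
    by (intro that[of f s]) (use f s s0s sa run gap flat_s[of s] in auto)
qed

text \<open>For these c the raised column s counts in the tail of \<open>B j\<close>, whereas s0,
  raised in the preceding pair, does not count in that of \<open>B (j - 1)\<close>; domination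
  survives only if there is slack. Up to f the slack spreads along the run of letters 2j, as the
  other tail loses at most one per column. From f on the height for 2j - 2 is constant, so
  membership in \<open>B (j - 1)\<close> persists towards s.\<close>

lemma strict_between:
  assumes j: "1 < j" "j \<le> k" and f: "1 \<le> f" "f \<le> s" "s \<le> a" and gap: "{f..s} \<inter> B j = {}"
    and fl: "g j f = g j s" and c: "s0 < c" "c \<le> s"
    and before: "s0 < f \<Longrightarrow> {Suc s0..<f} \<subseteq> B j \<and> tail (B j) (Suc s0) < tail (B (j - 1)) (Suc s0)"
    and corner: "f \<le> s0 \<Longrightarrow> s0 \<notin> B (j - 1) \<and> g (j - 1) (Suc s0) < g (j - 1) s0"
  shows "tail (B j) c < tail (B (j - 1)) c"
proof -
  have j1: "1 \<le> j - 1" using j by simp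
  have fin: "finite (B j)" "finite (B (j - 1))" using j j1 by simp_all
  have le: "tail (B j) x \<le> tail (B (j - 1)) x" for x using tail_B_le[of "j - 1" x] j by simp
  have Aj: "A j = {1..a}" using A_low j by simp
  have notB: "x \<notin> B j" if "f \<le> x" "x \<le> s" for x
    using that disjoint_iff[THEN iffD1, OF gap] by simp
  have flat_h: "h (j - 1) x = h (j - 1) f" if "f \<le> x" "x \<le> s" for x
  proof -
    have "g j x = g j f" using flat[of f x s j] that f fl by simp
    then show ?thesis using g_eq[of j x] g_eq[of j f] j that f Aj by simp
  qed
  have before': "tail (B j) x < tail (B (j - 1)) x" if "s0 < x" "x \<le> f" for x
  proof -
    have *: "{Suc s0..<x} \<subseteq> B j" "tail (B j) (Suc s0) < tail (B (j - 1)) (Suc s0)"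
      using before that by auto
    have "tail (B j) (Suc s0) = tail (B j) x + (x - Suc s0)"
      using tail_run[OF fin(1) _ *(1)] that by simp
    moreover have "tail (B (j - 1)) (Suc s0) \<le> tail (B (j - 1)) x + (x - Suc s0)"
      using tail_le_run[OF fin(2)] that by simp
    ultimately show ?thesis using *(2) by linarith
  qed
  show ?thesis
  proof (cases "c \<le> f")
    case True
    then show ?thesis using before' c by simp
  next
    case False
    have up: "y \<in> B (j - 1)" if "f \<le> x" "x \<le> y" "y \<le> s" "x \<in> B (j - 1)" for x y
    proof (rule ccontr)
      assume "y \<notin> B (j - 1)"
      moreover have "h (j - 1) x = h (j - 1) y" using flat_h[of x] flat_h[of y] that by simp
      moreover have "g (j - 1) y \<le> g (j - 1) x" using g_antimono[of x y] that f by simp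
      ultimately show False using h_eq[OF j1, of x] h_eq[OF j1, of y] that by simp
    qed
    show ?thesis
    proof (cases "c \<in> B (j - 1)")
      case True
      have "tail (B j) c = tail (B j) (Suc s)"
        by (rule tail_gap[OF fin(1)]) (use c False notB in auto)
      also have "\<dots> \<le> tail (B (j - 1)) (Suc s)" by (rule le)
      also have "\<dots> \<le> tail (B (j - 1)) (Suc c)" using tail_antimono[OF fin(2)] c by simp
      also have "\<dots> < tail (B (j - 1)) c" using tail_Suc[OF fin(2), of c] True by simp
      finally show ?thesis .
    next
      case notin: False
      have out: "x \<notin> B (j - 1)" if "f \<le> x" "x \<le> c" for x using up[of x c] notin c that by blast
      \<comment> \<open>Otherwise s0 and s0 + 1 both lie outside \<open>B (j - 1)\<close> and have
        equal heights for 2j - 2, hence also for 2j - 3, contrary to the corner at s0.\<close>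
      have "s0 < f"
      proof (rule ccontr)
        assume "\<not> s0 < f"
        then have s0: "f \<le> s0" "Suc s0 \<le> c" using c by auto
        then have "s0 \<notin> B (j - 1)" "Suc s0 \<notin> B (j - 1)" using out by auto
        moreover have "h (j - 1) s0 = h (j - 1) (Suc s0)" using flat_h[of s0] flat_h[of "Suc s0"] s0 c by simp
        ultimately show False using corner[OF s0(1)] h_eq[OF j1, of s0] h_eq[OF j1, of "Suc s0"] by simp
      qed
      have "tail (B j) c = tail (B j) f"
        by (rule tail_gap[OF fin(1), symmetric]) (use c False notB in auto)
      also have "\<dots> < tail (B (j - 1)) f" using before'[of f] \<open>s0 < f\<close> by simp
      also have "\<dots> = tail (B (j - 1)) c"
        by (rule tail_gap[OF fin(2)]) (use False out in auto)
      finally show ?thesis .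
    qed
  qed
qed

text \<open>The square raised in the pair of letters \<open>2 * j - 1\<close>, \<open>2 * j\<close> lies in column \<open>s\<close>, and \<open>f\<close> is
  the column of the leftmost \<open>2 * j - 1\<close> in its row that has no \<open>2 * j\<close> below it.\<close>

definition raisable :: "nat \<Rightarrow> nat \<Rightarrow> nat \<Rightarrow> bool" where
  "raisable j f s \<longleftrightarrow> 1 \<le> f \<and> f \<le> s \<and> s \<le> a \<and> {f..s} \<inter> B j = {} \<and> g j f = g j s \<and>
     g j (Suc s) < g j s \<and> tail (B j) f + f \<le> card (B m) + 1"

text \<open>The last clause records the slack from \<open>strict_between\<close>, which is available
  at the moment of choice and is what domination after raising requires.\<close>

definition leftmost_from :: "nat \<Rightarrow> nat \<Rightarrow> nat \<Rightarrow> bool" where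
  "leftmost_from j s0 s \<longleftrightarrow> s0 \<le> s \<and>
     (\<forall>c\<in>{1..a}. c \<notin> B j \<longrightarrow> g j (Suc c) < g j c \<longrightarrow> s0 \<le> c \<longrightarrow> s \<le> c) \<and>
     (1 < j \<longrightarrow> (\<forall>c. s0 < c \<and> c \<le> s \<longrightarrow> tail (B j) c < tail (B (j - 1)) c))"

lemma raisable_first: "\<exists>f s. raisable m f s \<and> leftmost_from m 0 s"
proof -
  have tail1: "tail (B j) 1 = card (B j)" if "1 \<le> j" for j
    using B_pos[OF that] by (rule tail_eq_card)
  have cm: "card (B m) < a" using small by (simp add: B_def)
  obtain f s where fs: "1 \<le> f" "f \<le> s" "s \<le> a" "{1..<f} \<subseteq> B m" "{f..s} \<inter> B m = {}"
    "g m f = g m s" "g m (Suc s) < g m s"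
    "\<And>c. c \<in> {1..a} \<Longrightarrow> c \<notin> B m \<Longrightarrow> g m (Suc c) < g m c \<Longrightarrow> 0 \<le> c \<Longrightarrow> s \<le> c"
    using next_square[of m 1 0] m tail1[of m] cm by auto
  \<comment> \<open>Crossing a run moves f East by exactly the number of letters that leave the
    tail, so the sum of both keeps its initial value \<open>card (B m) + 1\<close>. Passing to the
    next pair can only lower it.\<close>
  have "tail (B m) 1 = tail (B m) f + (f - 1)" using tail_run[OF _ fs(1,4)] m by simp
  then have "raisable m f s" unfolding raisable_def using fs tail1[of m] m by simp
  moreover have "tail (B m) c < tail (B (m - 1)) c" if "1 < m" "0 < c" "c \<le> s" for c
  proof (rule strict_between[of m f s 0 c])
    show "{Suc 0..<f} \<subseteq> B m \<and> tail (B m) (Suc 0) < tail (B (m - 1)) (Suc 0)"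
      using fs(4) tail1[of m] tail1[of "m - 1"] strict that by (simp add: B_def)
  qed (use that fs m in auto)
  ultimately show ?thesis
    unfolding leftmost_from_def using fs(8) by (intro exI[of _ f] exI[of _ s]) auto
qed

lemma raisable_next:
  assumes j: "m \<le> j" "j < k" and r: "raisable j f s"
  shows "\<exists>f' s'. raisable (Suc j) f' s' \<and> leftmost_from (Suc j) s s'"
proof -
  have j1: "1 \<le> j" using j m by simp
  have r': "1 \<le> f" "f \<le> s" "s \<le> a" "{f..s} \<inter> B j = {}" "g j f = g j s" "g j (Suc s) < g j s"
    "tail (B j) f + f \<le> card (B m) + 1"
    using r by (auto simp: raisable_def)
  have "f \<notin> B j" "s \<notin> B j" using r' by auto
  then have flat_h: "h j f = h j s" using h_eq[OF j1, of f] h_eq[OF j1, of s] r' by simp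
  have cm: "card (B m) < a" using small by (simp add: B_def)
  have room: "tail (B (Suc j)) f + f \<le> card (B m) + 1" using tail_B_le[OF j1, of f] r' by simp
  obtain f' s' where fs: "f \<le> f'" "f' \<le> s'" "s \<le> s'" "s' \<le> a" "{f..<f'} \<subseteq> B (Suc j)"
    "{f'..s'} \<inter> B (Suc j) = {}" "g (Suc j) f' = g (Suc j) s'" "g (Suc j) (Suc s') < g (Suc j) s'"
    "\<And>c. c \<in> {1..a} \<Longrightarrow> c \<notin> B (Suc j) \<Longrightarrow> g (Suc j) (Suc c) < g (Suc j) c \<Longrightarrow> s \<le> c \<Longrightarrow> s' \<le> c"
    using next_square[of "Suc j" f s] j r' flat_h room cm by auto
  have "tail (B (Suc j)) f = tail (B (Suc j)) f' + (f' - f)" using tail_run[OF _ fs(1,5)] by simp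
  then have "raisable (Suc j) f' s'" unfolding raisable_def using fs room r' by simp
  moreover have "tail (B (Suc j)) c < tail (B (Suc j - 1)) c" if "s < c" "c \<le> s'" for c
  proof (rule strict_between[of "Suc j" f' s' s c])
    assume "s < f'"
    \<comment> \<open>Here s lies in the run before f', so its column holds 2j + 2 but not 2j.
      Comparing the tails at s and at \<open>Suc s\<close> yields the strict inequality.\<close>
    then have "{Suc s..<f'} \<subseteq> B (Suc j)" "s \<in> B (Suc j)" using fs r' by auto
    then show "{Suc s..<f'} \<subseteq> B (Suc j) \<and> tail (B (Suc j)) (Suc s) < tail (B (Suc j - 1)) (Suc s)"
      using tail_Suc[of "B (Suc j)" s] tail_Suc[of "B j" s] tail_B_le[OF j1, of s] \<open>s \<notin> B j\<close> j1 by simp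
  next
    show "s \<notin> B (Suc j - 1) \<and> g (Suc j - 1) (Suc s) < g (Suc j - 1) s" using r' \<open>s \<notin> B j\<close> by simp
  qed (use that fs r' j j1 in auto)
  ultimately show ?thesis unfolding leftmost_from_def using fs(3,9) by blast
qed

lemma raisable_sequence:
  obtains F S where "\<And>j. m \<le> j \<Longrightarrow> j \<le> k \<Longrightarrow> raisable j (F j) (S j)"
    "leftmost_from m 0 (S m)" "\<And>j. m \<le> j \<Longrightarrow> j < k \<Longrightarrow> leftmost_from (Suc j) (S j) (S (Suc j))"
proof -
  \<comment> \<open>Dependent choice runs through all d, so both predicates are made vacuous once k
    is passed.\<close>
  define G where "G d p \<longleftrightarrow> m + d \<le> k \<longrightarrow> raisable (m + d) (fst p) (snd p) \<and> (d = 0 \<longrightarrow> leftmost_from m 0 (snd p))"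
    for d and p :: "nat \<times> nat"
  define R where "R d p q \<longleftrightarrow> m + d < k \<longrightarrow> leftmost_from (Suc (m + d)) (snd p) (snd q)"
    for d and p q :: "nat \<times> nat"
  have "\<exists>f. \<forall>d. G d (f d) \<and> R d (f d) (f (Suc d))"
  proof (rule dependent_nat_choice)
    show "\<exists>p. G 0 p" using raisable_first unfolding G_def by auto
  next
    fix p d assume "G d p"
    then show "\<exists>q. G (Suc d) q \<and> R d p q"
      using raisable_next[of "m + d" "fst p" "snd p"] unfolding G_def R_def
      by (cases "m + d < k") auto
  qed
  then obtain f where f: "\<And>d. G d (f d)" "\<And>d. R d (f d) (f (Suc d))" by blast
  show thesis
  proof (rule that[of "\<lambda>j. fst (f (j - m))" "\<lambda>j. snd (f (j - m))"])
    show "raisable j (fst (f (j - m))) (snd (f (j - m)))" if "m \<le> j" "j \<le> k" for j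
      using f(1)[of "j - m"] that unfolding G_def by simp
    show "leftmost_from m 0 (snd (f (m - m)))" using f(1)[of 0] m unfolding G_def by simp
    show "leftmost_from (Suc j) (snd (f (j - m))) (snd (f (Suc j - m)))" if "m \<le> j" "j < k" for j
      using f(2)[of "j - m"] that unfolding R_def by (simp add: Suc_diff_le)
  qed
qed

end

section \<open>Swapping in the remaining pairs of letters\<close>

lemma exch_empty: "exch C (\<lambda>_. {}) (\<lambda>_. {}) = C"
  by (simp add: exch_def fun_eq_iff)

lemma tail_0: "tail X 0 = card X"
  by (simp add: tail_eq_card)

lemma tail_single: "tail {x} c = of_bool (c \<le> x)"
  using tail_insert[of "{}" x c] by (simp add: tail_def)

lemma dominatesI:
  assumes "finite X" "finite Y" "0 \<notin> X" "0 \<notin> Y" "\<And>c. 1 \<le> c \<Longrightarrow> tail Y c \<le> tail X c"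
  shows "dominates X Y"
  unfolding dominates_def
proof
  fix c
  have "tail Y 0 = tail Y 1" "tail X 0 = tail X 1"
    using tail_Suc[of Y 0] tail_Suc[of X 0] assms by simp_all
  then show "tail Y c \<le> tail X c" using assms(5)[of c] assms(5)[of 1] by (cases "c = 0") auto
qed

lemma dominates_single:
  assumes "finite X" "y \<in> X" "x \<le> y"
  shows "dominates X {x}"
  unfolding dominates_def tail_single
  using assms tail_pos[of X y] by (auto simp: Suc_le_eq)

context family
begin

text \<open>In a tableau in which a swap is due, the start of the row segment of \<open>g j\<close> that contains the
  last \<open>2 * j\<close> is the column of the rightmost changeable \<open>2 * j\<close>.\<close>

definition start :: "nat \<Rightarrow> nat" where
  "start j = (LEAST y. 1 \<le> y \<and> g j y = g j (Max (B j)))"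

text \<open>Every column of the segment ending at the last 2j must hold 2j, since heights for 2j do
  not increase to the East. These letters fill part of one row without a break; the first of them is
  a corner, and no later column of the segment is.\<close>

lemma
  assumes j: "1 \<le> j" and ne: "B j \<noteq> {}"
  shows start_ge: "1 \<le> start j" and g_start: "g j (start j) = g j (Max (B j))"
    and start_le: "start j \<le> Max (B j)" and start_run: "{start j..Max (B j)} \<subseteq> B j"
    and start_corner: "start j = 1 \<or> g j (start j) < g j (start j - 1)"
    and start_least: "1 \<le> y \<Longrightarrow> g j y = g j (Max (B j)) \<Longrightarrow> start j \<le> y"
    and start_max: "c \<in> B j \<Longrightarrow> c = 1 \<or> g j c < g j (c - 1) \<Longrightarrow> c \<le> start j"
proof -
  let ?b = "Max (B j)"
  have b: "?b \<in> B j" "1 \<le> ?b" using Max_in[of "B j"] ne j B_pos[OF j, of ?b] by auto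
  have "1 \<le> start j \<and> g j (start j) = g j ?b"
    unfolding start_def by (rule LeastI[of _ ?b]) (use b in auto)
  then show 1: "1 \<le> start j" and 2: "g j (start j) = g j ?b" by auto
  show 3: "start j \<le> y" if "1 \<le> y" "g j y = g j ?b" for y
    unfolding start_def by (rule Least_le) (use that in auto)
  show 4: "start j \<le> ?b" using 3[of ?b] b by simp
  have fl: "g j y = g j ?b" if "start j \<le> y" "y \<le> ?b" for y
    using flat[OF 1 that 2] .
  show "{start j..?b} \<subseteq> B j"
  proof
    fix y assume y: "y \<in> {start j..?b}"
    then have "h j ?b \<le> h j y" using 1 by (intro h_antimono) auto
    then show "y \<in> B j" using h_eq[OF j, of y] h_eq[OF j, of ?b] fl[of y] y b by (cases "y \<in> B j") auto
  qed
  show "start j = 1 \<or> g j (start j) < g j (start j - 1)"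
  proof (rule ccontr)
    assume neg: "\<not> ?thesis"
    then have "1 \<le> start j - 1" using 1 by linarith
    moreover from this have "g j (start j) \<le> g j (start j - 1)" by (rule g_antimono) simp
    ultimately have "start j \<le> start j - 1" using neg 2 by (intro 3) auto
    then show False using 1 by linarith
  qed
  show "c \<le> start j" if c: "c \<in> B j" "c = 1 \<or> g j c < g j (c - 1)"
  proof (rule ccontr)
    assume neg: "\<not> c \<le> start j"
    then have "start j \<le> c - 1" "c \<noteq> 1" "c \<le> ?b" using 1 c Max_ge[of "B j" c] j by auto
    then show False using fl[of c] fl[of "c - 1"] neg c by auto
  qed
qed

end

text \<open>Beyond k, \<open>S j\<close> denotes the column of the single letter 2j - 1. Raising and
  swapping then both move \<open>S j\<close> from the odd set to the even one, so that one formula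
  describes every stage.\<close>

locale raised_family = family +
  fixes F S :: "nat \<Rightarrow> nat"
  assumes rais: "m \<le> j \<Longrightarrow> j \<le> k \<Longrightarrow> raisable j (F j) (S j)"
    and first: "leftmost_from m 0 (S m)"
    and "next": "m \<le> j \<Longrightarrow> j < k \<Longrightarrow> leftmost_from (Suc j) (S j) (S (Suc j))"
    and S_mid: "k < j \<Longrightarrow> S j = the_elem (A j)"
begin

definition stage :: "nat \<Rightarrow> nat \<Rightarrow> nat set" where
  "stage l = exch C (\<lambda>j. if m \<le> j \<and> j \<le> l then {S j} else {})
     (\<lambda>j. if k < j \<and> j \<le> l then {start j} else {})"

text \<open>The clause on \<open>B (j - 1)\<close> serves twice: it controls where the segment of
  consecutive swaps begins, and it rules out preimages with different numbers of swaps.\<close>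

definition swappable :: "nat \<Rightarrow> bool" where
  "swappable j \<longleftrightarrow> j < n \<and> B j \<noteq> {} \<and> (\<forall>b\<in>B j. b < S j) \<and> (\<forall>b\<in>B (j - 1). b < S j)"

lemma A_mid: "k < j \<Longrightarrow> j < n \<Longrightarrow> A j = {S j}"
  using card_mid[of j] S_mid[of j] unfolding A_def by (metis card_1_singletonE the_elem_eq)

lemma S_low:
  assumes "m \<le> j" "j \<le> k"
  shows "S j \<in> {1..a}" "S j \<notin> B j" "g j (Suc (S j)) < g j (S j)"
  using rais[OF assms] unfolding raisable_def by auto

lemma S_step: "m \<le> j \<Longrightarrow> j < k \<Longrightarrow> S j \<le> S (Suc j)"
  using "next"[of j] unfolding leftmost_from_def by blast

lemma start_less: "swappable j \<Longrightarrow> 1 \<le> j \<Longrightarrow> start j < S j"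
  using start_le[of j] Max_in[of "B j"] unfolding swappable_def by fastforce

lemma start_in: "1 \<le> j \<Longrightarrow> B j \<noteq> {} \<Longrightarrow> start j \<in> B j"
  using start_run[of j] start_le[of j] by auto

lemma S_drop: "k < j \<Longrightarrow> j < n \<Longrightarrow> 1 \<le> S j \<and> g j (Suc (S j)) < g j (S j)"
proof -
  assume j: "k < j" "j < n"
  then have j1: "1 \<le> j" by simp
  have A: "A j = {S j}" using A_mid j by simp
  then have "1 \<le> S j" using A_pos[OF j1, of "S j"] by simp
  moreover have "h (j - 1) (Suc (S j)) \<le> h (j - 1) (S j)" by (rule h_antimono) (use calculation in auto)
  ultimately show ?thesis using g_eq[OF j1, of "S j"] g_eq[OF j1, of "Suc (S j)"] A by simp
qed

lemma stage_exchangeable: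
  assumes sw: "\<And>j. k < j \<Longrightarrow> j \<le> l \<Longrightarrow> swappable j"
  shows "exchangeable C (\<lambda>j. if m \<le> j \<and> j \<le> l then {S j} else {})
     (\<lambda>j. if k < j \<and> j \<le> l then {start j} else {})"
proof -
  have "S j \<in> A j - B j" if "m \<le> j" "j \<le> l" for j
  proof (cases "j \<le> k")
    case True
    then show ?thesis using S_low[of j] A_low[of j] that m by auto
  next
    case False
    then show ?thesis using A_mid[of j] sw[of j] that unfolding swappable_def by auto
  qed
  moreover have "start j \<in> B j - A j" if "k < j" "j \<le> l" for j
    using start_in[of j] start_less[of j] A_mid[of j] sw[of j] that unfolding swappable_def by auto
  ultimately show ?thesis unfolding exchangeable_def A_def B_def by simp
qed

lemma stage_valid:
  assumes sw: "\<And>j. k < j \<Longrightarrow> j \<le> l \<Longrightarrow> swappable j"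
  shows "valid (stage l)"
  unfolding stage_def
proof (rule valid_exch_corners[OF valid stage_exchangeable[OF sw]], assumption, assumption)
  fix j :: nat
  assume j: "1 \<le> j"
  let ?P = "if m \<le> j \<and> j \<le> l then {S j} else {}" and ?Q = "if k < j \<and> j \<le> l then {start j} else {}"
  let ?g = "ht C (2 * j - 1)"
  consider "\<not> (m \<le> j \<and> j \<le> l)" | "m \<le> j" "j \<le> k" "j \<le> l" | "k < j" "j \<le> l" using m by linarith
  then show "?P = {} \<and> ?Q = {} \<or>
      (\<exists>s. ?P = {s} \<and> ?g (Suc s) < ?g s \<and>
         (?Q = {} \<or> (\<exists>t<s. ?Q = {t} \<and> (t = 1 \<or> ?g t < ?g (t - 1)))))"
  proof cases
    case 1
    then show ?thesis using m by auto
  next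
    case 2
    then show ?thesis using S_low(3)[of j] unfolding g_def by auto
  next
    case 3
    then have "swappable j" by (rule sw)
    then have "start j < S j" "start j = 1 \<or> g j (start j) < g j (start j - 1)" "g j (Suc (S j)) < g j (S j)"
      using start_less start_corner S_drop 3 j unfolding swappable_def by auto
    then show ?thesis using 3 m unfolding g_def by auto
  qed
qed

lemma stage_Suc:
  assumes "m \<le> Suc l"
  shows "stage (Suc l) = (let q = (if k < Suc l then {start (Suc l)} else {}) in
    (stage l)(2 * Suc l - 1 := A (Suc l) - {S (Suc l)} \<union> q, 2 * Suc l := B (Suc l) - q \<union> {S (Suc l)}))"
proof -
  have P: "(\<lambda>j. if m \<le> j \<and> j \<le> Suc l then {S j} else {}) =
    (\<lambda>j. if m \<le> j \<and> j \<le> l then {S j} else {})(Suc l := {S (Suc l)})"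
    using assms by (auto simp: fun_eq_iff le_Suc_eq)
  have Q: "(\<lambda>j. if k < j \<and> j \<le> Suc l then {start j} else {}) =
    (\<lambda>j. if k < j \<and> j \<le> l then {start j} else {})(Suc l := (if k < Suc l then {start (Suc l)} else {}))"
    by (auto simp: fun_eq_iff le_Suc_eq)
  show ?thesis
    unfolding stage_def P Q Let_def A_def B_def by (rule exch_upd[symmetric]) simp
qed

text \<open>Exchanges up to l keep the heights for 2l, so the next pair of letters is seen exactly
  as in C.\<close>

lemma stage_next:
  "stage l (2 * Suc l - 1) = A (Suc l)" "stage l (2 * Suc l) = B (Suc l)"
  "(\<And>j. k < j \<Longrightarrow> j \<le> l \<Longrightarrow> swappable j) \<Longrightarrow> ht (stage l) (2 * Suc l - 1) = g (Suc l)"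
proof -
  show "stage l (2 * Suc l - 1) = A (Suc l)"
    unfolding stage_def by (subst exch_odd) (auto simp: A_def)
  show "stage l (2 * Suc l) = B (Suc l)"
    unfolding stage_def exch_even by (auto simp: B_def)
  assume "\<And>j. k < j \<Longrightarrow> j \<le> l \<Longrightarrow> swappable j"
  then show "ht (stage l) (2 * Suc l - 1) = g (Suc l)"
    using ht_exch_odd[OF stage_exchangeable[of l], of "Suc l"] by (auto simp: fun_eq_iff stage_def g_def)
qed

lemma raise_stage:
  assumes j: "m \<le> Suc l" "Suc l \<le> k" and lm: "leftmost_from (Suc l) c0 (S (Suc l))"
  shows "raise_step (Suc l) (tab (stage l), c0) = Some (tab (stage (Suc l)), S (Suc l))"
proof -
  have Al: "A (Suc l) = {1..a}" using A_low[of "Suc l"] j by simp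
  note S = S_low[OF j]
  have "raise_step (Suc l) (tab (stage l), c0) = Some (tab ((stage l)(2 * Suc l - 1 :=
    stage l (2 * Suc l - 1) - {S (Suc l)}, 2 * Suc l := insert (S (Suc l)) (stage l (2 * Suc l)))), S (Suc l))"
  proof (rule raise_step_tab)
    show "valid (stage l)" using j by (intro stage_valid) auto
    show "1 \<le> Suc l" by simp
    have ht: "ht (stage l) (2 * Suc l - 1) = g (Suc l)" using j by (intro stage_next) auto
    show "S (Suc l) \<in> stage l (2 * Suc l - 1)" "S (Suc l) \<notin> stage l (2 * Suc l)"
      unfolding stage_next(1,2) Al using S by auto
    show "ht (stage l) (2 * Suc l - 1) (Suc (S (Suc l))) < ht (stage l) (2 * Suc l - 1) (S (Suc l))"
      unfolding ht using S by simp
    show "c0 \<le> S (Suc l)" using lm unfolding leftmost_from_def by blast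
    show "S (Suc l) \<le> c" if "c \<in> stage l (2 * Suc l - 1)" "c \<notin> stage l (2 * Suc l)"
      "ht (stage l) (2 * Suc l - 1) (Suc c) < ht (stage l) (2 * Suc l - 1) c" "c0 \<le> c" for c
      using that lm unfolding stage_next(1,2) ht Al leftmost_from_def by blast
  qed
  also have "(stage l)(2 * Suc l - 1 := stage l (2 * Suc l - 1) - {S (Suc l)},
    2 * Suc l := insert (S (Suc l)) (stage l (2 * Suc l))) = stage (Suc l)"
    unfolding stage_Suc[OF j(1)] stage_next(1,2) using j by (simp add: Let_def)
  finally show ?thesis .
qed

lemma raise_steps_stage: "m + d \<le> k \<Longrightarrow> raise_steps m d (tab C) = Some (tab (stage (m + d)), S (m + d))"
proof (induction d)
  case 0
  have "(\<lambda>j. if m \<le> j \<and> j \<le> m - 1 then {S j} else {}) = (\<lambda>_. {})"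
    "(\<lambda>j. if k < j \<and> j \<le> m - 1 then {start j} else {}) = (\<lambda>_. {})"
    using m by (auto simp: fun_eq_iff)
  then have "stage (m - 1) = C" unfolding stage_def by (simp add: exch_empty)
  then show ?case using raise_stage[of "m - 1" 0] first m by simp
next
  case (Suc d)
  then show ?case using raise_stage[of "m + d" "S (m + d)"] "next"[of "m + d"] by simp
qed

lemma tail_stage_odd:
  assumes sw: "\<And>j. k < j \<Longrightarrow> j \<le> l \<Longrightarrow> swappable j" and j: "1 \<le> j"
  shows "tail (stage l (2 * j - 1)) c + of_bool (m \<le> j \<and> j \<le> l \<and> c \<le> S j) =
    tail (A j) c + of_bool (k < j \<and> j \<le> l \<and> c \<le> start j)"
proof -
  have ex: "(if m \<le> j \<and> j \<le> l then {S j} else {}) \<subseteq> A j - B j"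
    "(if k < j \<and> j \<le> l then {start j} else {}) \<subseteq> B j - A j"
    using stage_exchangeable[OF sw] j unfolding exchangeable_def A_def B_def by blast+
  have st: "stage l (2 * j - 1) = A j - (if m \<le> j \<and> j \<le> l then {S j} else {}) \<union>
      (if k < j \<and> j \<le> l then {start j} else {})"
    unfolding stage_def exch_odd[OF j] A_def ..
  have "tail (stage l (2 * j - 1)) c = tail (A j - (if m \<le> j \<and> j \<le> l then {S j} else {})) c +
      of_bool (k < j \<and> j \<le> l \<and> c \<le> start j)"
    unfolding st using ex tail_insert[of "A j - (if m \<le> j \<and> j \<le> l then {S j} else {})" "start j" c] j
    by auto
  moreover have "tail (A j) c = tail (A j - (if m \<le> j \<and> j \<le> l then {S j} else {})) c +
      of_bool (m \<le> j \<and> j \<le> l \<and> c \<le> S j)"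
    using ex tail_remove[of "A j" "S j" c] j by auto
  ultimately show ?thesis by simp
qed

lemma tail_stage_even:
  assumes sw: "\<And>j. k < j \<Longrightarrow> j \<le> l \<Longrightarrow> swappable j" and j: "1 \<le> j"
  shows "tail (stage l (2 * j)) c + of_bool (k < j \<and> j \<le> l \<and> c \<le> start j) =
    tail (B j) c + of_bool (m \<le> j \<and> j \<le> l \<and> c \<le> S j)"
proof -
  have ex: "(if m \<le> j \<and> j \<le> l then {S j} else {}) \<subseteq> A j - B j"
    "(if k < j \<and> j \<le> l then {start j} else {}) \<subseteq> B j - A j"
    using stage_exchangeable[OF sw] j unfolding exchangeable_def A_def B_def by blast+
  have st: "stage l (2 * j) = B j - (if k < j \<and> j \<le> l then {start j} else {}) \<union>
      (if m \<le> j \<and> j \<le> l then {S j} else {})"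
    unfolding stage_def exch_even B_def ..
  have "tail (stage l (2 * j)) c = tail (B j - (if k < j \<and> j \<le> l then {start j} else {})) c +
      of_bool (m \<le> j \<and> j \<le> l \<and> c \<le> S j)"
    unfolding st using ex tail_insert[of "B j - (if k < j \<and> j \<le> l then {start j} else {})" "S j" c] j
    by auto
  moreover have "tail (B j) c = tail (B j - (if k < j \<and> j \<le> l then {start j} else {})) c +
      of_bool (k < j \<and> j \<le> l \<and> c \<le> start j)"
    using ex tail_remove[of "B j" "start j" c] j by auto
  ultimately show ?thesis by simp
qed

text \<open>Odd sets: the removed columns move weakly East with j, so whenever the dominating tail
  loses one, so does the other; only at j = k does the next set lose nothing. Even sets:
  \<open>S (Suc j)\<close> counts without \<open>S j\<close> just for the c between them, where the
  slack of \<open>leftmost_from\<close> applies.\<close>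

lemma dominates_stage_k:
  assumes v: "1 \<le> v" "v \<noteq> 2 * k - 1"
  shows "dominates (stage k v) (stage k (v + 2))"
proof -
  have sw: "swappable j" if "k < j" "j \<le> k" for j using that by simp
  have val: "valid (stage k)" using stage_valid[of k] by simp
  have odd: "tail (stage k (2 * j - 1)) c + of_bool (m \<le> j \<and> j \<le> k \<and> c \<le> S j) = tail (A j) c"
    and even: "tail (stage k (2 * j)) c = tail (B j) c + of_bool (m \<le> j \<and> j \<le> k \<and> c \<le> S j)"
    if "1 \<le> j" for j c
  proof -
    show "tail (stage k (2 * j - 1)) c + of_bool (m \<le> j \<and> j \<le> k \<and> c \<le> S j) = tail (A j) c"
      "tail (stage k (2 * j)) c = tail (B j) c + of_bool (m \<le> j \<and> j \<le> k \<and> c \<le> S j)"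
      using tail_stage_odd[where l = k and j = j and c = c, OF sw that]
        tail_stage_even[where l = k and j = j and c = c, OF sw that]
      by (cases "k < j"; simp)+
  qed
  show ?thesis
  proof (rule dominatesI)
    show "finite (stage k v)" "finite (stage k (v + 2))" "0 \<notin> stage k v" "0 \<notin> stage k (v + 2)"
      using val v unfolding valid_def by auto
    fix c :: nat
    assume c: "1 \<le> c"
    from v(1) show "tail (stage k (v + 2)) c \<le> tail (stage k v) c"
    proof (cases rule: letter_cases)
      case (1 j)
      then have v2: "v + 2 = 2 * Suc j - 1" by simp
      have "tail (A (Suc j)) c \<le> tail (A j) c" using dom_A[OF 1(1)] by (simp add: dominates_def)
      moreover have "m \<le> Suc j \<and> Suc j \<le> k \<and> c \<le> S (Suc j)" if "m \<le> j \<and> j \<le> k \<and> c \<le> S j"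
        using that S_step[of j] v 1 by (metis le_Suc_eq le_neq_implies_less Suc_leI le_trans)
      ultimately show ?thesis
        using odd[OF 1(1), of c] odd[of "Suc j" c]
        unfolding v2 unfolding 1(2)
        by (cases "m \<le> j \<and> j \<le> k \<and> c \<le> S j"; cases "m \<le> Suc j \<and> Suc j \<le> k \<and> c \<le> S (Suc j)") auto
    next
      case (2 j)
      then have v2: "v + 2 = 2 * Suc j" by simp
      have "tail (B (Suc j)) c \<le> tail (B j) c" using tail_B_le 2 by simp
      moreover have "tail (B (Suc j)) c < tail (B j) c"
        if "m \<le> Suc j \<and> Suc j \<le> k \<and> c \<le> S (Suc j)" "\<not> (m \<le> j \<and> j \<le> k \<and> c \<le> S j)"
      proof (cases "m \<le> j")
        case True
        then show ?thesis using that "next"[of j] 2 unfolding leftmost_from_def by auto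
      next
        case False
        then have "m = Suc j" using that by simp
        then show ?thesis using that first 2 c unfolding leftmost_from_def by auto
      qed
      ultimately show ?thesis
        using even[OF 2(1), of c] even[of "Suc j" c]
        unfolding v2 unfolding 2(2)
        by (cases "m \<le> j \<and> j \<le> k \<and> c \<le> S j"; cases "m \<le> Suc j \<and> Suc j \<le> k \<and> c \<le> S (Suc j)") auto
    qed
  qed
qed

end

section \<open>Failures of domination and the swaps that repair them\<close>

lemma dominates_empty: "dominates X {}"
  by (simp add: dominates_def tail_def)

context raised_family
begin

text \<open>The equation \<open>card (B m) = a - 1\<close> is carried along from the first failure,
  because \<open>nonempty\<close> needs it at every later swap.\<close>

definition reached :: "nat \<Rightarrow> bool" where
  "reached l \<longleftrightarrow> k \<le> l \<and> l < n \<and> (\<forall>j. k < j \<and> j \<le> l \<longrightarrow> swappable j) \<and>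
     (k < l \<longrightarrow> card (B m) = a - 1) \<and>
     (\<forall>v\<ge>1. v \<noteq> 2 * l - 1 \<longrightarrow> dominates (stage l v) (stage l (v + 2)))"

lemma reached_k: "reached k"
  unfolding reached_def using m dominates_stage_k by auto

lemma stage_k_odd: "stage k (2 * k - 1) = {1..a} - {S k}"
  unfolding stage_def using exch_odd[of k] A_low[of k] m by (simp add: A_def)

lemma stage_odd: "k < l \<Longrightarrow> l < n \<Longrightarrow> stage l (2 * l - 1) = {start l}"
  unfolding stage_def using exch_odd[of l] A_mid[of l] m by (simp add: A_def)

text \<open>All of \<open>{1..a}\<close> except \<open>S k\<close> must lie West of the letter 2k +
  1, itself in one of these columns. As a >= 2, this puts \<open>S k\<close> and
  \<open>S (Suc k)\<close> both in column a.\<close>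

lemma blocked_first:
  assumes n: "Suc k < n" and nd: "\<not> dominates (stage k (2 * k - 1)) (A (Suc k))"
  shows "S k = a" "S (Suc k) = a" "card (B m) = a - 1" "\<forall>b\<in>B k. b < a"
proof -
  have A: "A (Suc k) = {S (Suc k)}" using A_mid n by simp
  have less: "y < S (Suc k)" if "y \<in> {1..a} - {S k}" for y
    using nd dominates_single[of "{1..a} - {S k}" y "S (Suc k)"] that
    unfolding A stage_k_odd by (meson finite_Diff finite_atLeastAtMost not_le)
  have "\<exists>x\<in>A k. S (Suc k) \<le> x"
    using dominates_ex[OF _ dom_A[of k], of "S (Suc k)"] m A by auto
  then have le: "S (Suc k) \<le> a" using A_low[of k] m by auto
  have a: "2 \<le> a" using a2 n by simp
  show Sk: "S k = a" using less[of a] le a by fastforce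
  show Sk': "S (Suc k) = a" using less[of "a - 1"] le a Sk by fastforce
  have r: "raisable k (F k) (S k)" using rais m by simp
  \<comment> \<open>Otherwise the columns a - 1 and a have equal height for 2k, and the only 2k + 1,
    in column a, would have an empty square or a larger letter to its left.\<close>
  have Fk: "F k = a"
  proof (rule ccontr)
    assume "F k \<noteq> a"
    then have F: "1 \<le> F k" "F k \<le> a - 1" using r Sk unfolding raisable_def by auto
    have "g k (a - 1) = g k a"
      by (rule flat[OF F]) (use r Sk in \<open>auto simp: raisable_def\<close>)
    moreover have "a - 1 \<in> {F k..S k}" "a \<in> {F k..S k}" using F Sk by auto
    then have "a - 1 \<notin> B k" "a \<notin> B k" using r unfolding raisable_def disjoint_iff by blast+
    ultimately have "h k (a - 1) = h k a" using h_eq[of k "a - 1"] h_eq[of k a] m by simp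
    moreover have "g (Suc k) a \<le> g (Suc k) (a - 1)" by (rule g_antimono) (use a in auto)
    moreover have "a - 1 \<notin> A (Suc k)" "a \<in> A (Suc k)" using A Sk' a by auto
    ultimately show False
      using g_eq[of "Suc k" a] g_eq[of "Suc k" "a - 1"] by simp
  qed
  \<comment> \<open>With f = a the bound in \<open>raisable\<close> reads
    \<open>tail (B k) a + a\<close> <= \<open>card (B m) + 1\<close> <= a, so equality holds and the
    tail vanishes.\<close>
  have "card (B m) < a" using small by (simp add: B_def)
  moreover have "tail (B k) a + a \<le> card (B m) + 1" using r Fk unfolding raisable_def by simp
  ultimately show "card (B m) = a - 1" "\<forall>b\<in>B k. b < a"
    using tail_pos[of "B k" _ a] m by (auto simp: not_less[symmetric])
qed

lemma g_before:
  assumes "k \<le> l" "Suc l < n" "y \<noteq> S (Suc l)"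
  shows "g (Suc l) y = h l y"
  using g_eq[of "Suc l" y] A_mid[of "Suc l"] assms by simp

text \<open>If the last 2l were weakly East of the blocking 2l + 1 in column x, the run of letters
  2l would contain x - 1 and x. Their heights for 2l would agree, and the 2l + 1 in column x would
  lack a smaller or equal left neighbour.\<close>

lemma blocked_later:
  assumes l: "k < l" "Suc l < n" and sw: "swappable l"
    and nd: "\<not> dominates (stage l (2 * l - 1)) (A (Suc l))"
  shows "start l < S (Suc l)" "\<forall>b\<in>B l. b < S (Suc l)"
proof -
  let ?x = "S (Suc l)" and ?b = "Max (B l)"
  have l1: "1 \<le> l" and ne: "B l \<noteq> {}" using l sw unfolding swappable_def by auto
  have A: "A (Suc l) = {?x}" using A_mid l by simp
  have "stage l (2 * l - 1) = {start l}" using stage_odd l by simp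
  then show less: "start l < ?x"
    using nd dominates_single[of "{start l}" "start l" ?x] unfolding A by (auto simp: not_le[symmetric])
  have "?b < ?x"
  proof (rule ccontr)
    assume "\<not> ?b < ?x"
    then have in_run: "?x \<in> {start l..?b}" "?x - 1 \<in> {start l..?b}" using less by auto
    then have mem: "?x \<in> B l" "?x - 1 \<in> B l" using start_run[OF l1 ne] by blast+
    have "g l y = g l ?b" if "y \<in> {start l..?b}" for y
      by (rule flat[OF start_ge[OF l1 ne] _ _ g_start[OF l1 ne]]) (use that in auto)
    from this[OF in_run(1)] this[OF in_run(2)] mem have "h l ?x = h l (?x - 1)"
      using h_eq[OF l1, of ?x] h_eq[OF l1, of "?x - 1"] by simp
    moreover have x1: "1 \<le> ?x - 1" using in_run start_ge[OF l1 ne] by auto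
    moreover from x1 have "g (Suc l) ?x \<le> g (Suc l) (?x - 1)" by (rule g_antimono) simp
    moreover have "?x \<in> A (Suc l)" "?x - 1 \<notin> A (Suc l)" using A less by auto
    ultimately show False
      using g_eq[of "Suc l" ?x] g_eq[of "Suc l" "?x - 1"] by simp
  qed
  then show "\<forall>b\<in>B l. b < ?x" using l1 by (auto dest!: Max_ge[OF finite_B[OF l1]])
qed

text \<open>Up to the last 2l the heights for 2l + 1 and 2l agree, so both are constant on the run
  of letters 2l. If the last 2l + 2 falls into that run, its own segment reaches back at least to
  \<open>start l\<close>.\<close>

lemma start_Suc_le:
  assumes l: "k < l" "Suc l < n" and sw: "swappable l" "swappable (Suc l)"
  shows "start (Suc l) \<le> start l"
proof -
  let ?x = "S (Suc l)" and ?b = "Max (B l)" and ?b' = "Max (B (Suc l))"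
  have l1: "1 \<le> l" and ne: "B l \<noteq> {}" "B (Suc l) \<noteq> {}" and x: "\<forall>b\<in>B l. b < ?x"
    using l sw unfolding swappable_def by auto
  have b': "?b' \<in> B (Suc l)" using ne by simp
  show ?thesis
  proof (cases "?b' < start l")
    case True
    moreover have "start (Suc l) \<le> ?b'" using start_le[of "Suc l"] ne by simp
    ultimately show ?thesis by linarith
  next
    case False
    have "\<exists>b\<in>B l. ?b' \<le> b" using dominates_ex[OF _ dom_B[OF l1] b'] by simp
    then have b'b: "?b' \<le> ?b" using Max_ge[OF finite_B[OF l1]] le_trans by blast
    have "?b \<in> B l" using ne l1 by simp
    then have bx: "?b < ?x" using x by blast
    have fl: "g (Suc l) y = h l ?b" if "start l \<le> y" "y \<le> ?b" for y
    proof -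
      have "g l y = g l ?b" using flat[OF start_ge[OF l1 ne(1)] that g_start[OF l1 ne(1)]] .
      moreover have "y \<in> B l" using start_run[OF l1 ne(1)] that by auto
      moreover have "g (Suc l) y = h l y" using g_before[of l y] l that bx by simp
      ultimately show ?thesis using h_eq[OF l1, of y] h_eq[OF l1, of ?b] \<open>?b \<in> B l\<close> by simp
    qed
    show ?thesis
      using start_least[of "Suc l" "start l"] ne start_ge[OF l1 ne(1)]
        fl[of "start l"] fl[of ?b'] False b'b by simp
  qed
qed

text \<open>For these c, the gain \<open>S l\<close> and the loss \<open>start l\<close> cancel in
  one tail, while the other tail only gains, so slack is needed. Either no 2l + 2 is left weakly
  East of c; or \<open>B l\<close> misses the part of the run of letters 2l + 2 West of c; or it
  contains the rest of that run and, by the corner at \<open>start l\<close>, a column beyond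
  it.\<close>

lemma swap_strict:
  assumes l: "k < l" "Suc l < n" and sw: "swappable l" "swappable (Suc l)"
    and c: "start (Suc l) < c" "c \<le> start l"
  shows "tail (B (Suc l)) c < tail (B l) c"
proof -
  let ?x = "S (Suc l)" and ?b = "Max (B l)" and ?b' = "Max (B (Suc l))" and ?t = "start (Suc l)"
  have l1: "1 \<le> l" "1 \<le> Suc l" and ne: "B l \<noteq> {}" "B (Suc l) \<noteq> {}" and x: "\<forall>b\<in>B (Suc l). b < ?x"
    using l sw unfolding swappable_def by auto
  have fin: "finite (B l)" "finite (B (Suc l))" using l1 by auto
  have b: "?b \<in> B l" "?b' \<in> B (Suc l)" using ne fin Max_in by blast+
  note t1 = start_ge[OF l1(2) ne(2)]
  have run: "{?t..?b'} \<subseteq> B (Suc l)" by (rule start_run[OF l1(2) ne(2)])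
  show ?thesis
  proof (cases "?b' < c")
    case True
    then have "tail (B (Suc l)) c = 0"
      using Max_ge[OF fin(2)] by (intro tail_eq_0) (meson le_less_trans)
    moreover have "0 < tail (B l) c" using tail_pos[OF fin(1) start_in[OF l1(1) ne(1)] c(2)] .
    ultimately show ?thesis by simp
  next
    case False
    have flat_h: "h l y = h l ?b'" if "?t \<le> y" "y \<le> ?b'" for y
    proof -
      have "g (Suc l) y = g (Suc l) ?b'" using flat[OF t1 that g_start[OF l1(2) ne(2)]] .
      moreover have "?b' < ?x" using x b by blast
      ultimately show ?thesis using g_before[of l y] g_before[of l ?b'] l that by simp
    qed
    have up: "z \<in> B l" if "?t \<le> y" "y \<le> z" "z \<le> ?b'" "y \<in> B l" for y z
    proof (rule ccontr)
      assume "z \<notin> B l"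
      moreover have "h l y = h l z" using flat_h[of y] flat_h[of z] that by simp
      moreover have "g l z \<le> g l y" using g_antimono[of y z] that t1 by simp
      ultimately show False using h_eq[OF l1(1), of y] h_eq[OF l1(1), of z] that by simp
    qed
    have strict: ?thesis if "\<And>y. ?t \<le> y \<Longrightarrow> y < c \<Longrightarrow> y \<notin> B l"
    proof -
      have "tail (B l) ?t = tail (B l) c" by (rule tail_gap[OF fin(1)]) (use c that in auto)
      moreover have "tail (B (Suc l)) ?t = tail (B (Suc l)) c + (c - ?t)"
        by (rule tail_run[OF fin(2)]) (use c False run in auto)
      ultimately show ?thesis using tail_B_le[OF l1(1), of ?t] c by simp
    qed
    show ?thesis
    proof (cases "c - 1 \<in> B l")
      case notin: False
      have "y \<notin> B l" if "?t \<le> y" "y < c" for y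
      proof -
        have "y \<le> c - 1" "c - 1 \<le> ?b'" using that False by linarith+
        then show ?thesis using up[of y "c - 1"] notin that by blast
      qed
      then show ?thesis by (rule strict)
    next
      case True
      have seg: "y \<in> B l" if "c - 1 \<le> y" "y \<le> ?b'" for y
        using up[of "c - 1" y] True that c by auto
      have "tail (B (Suc l)) c = tail (B (Suc l)) (Suc ?b') + (Suc ?b' - c)"
        by (rule tail_run[OF fin(2)]) (use c False run in auto)
      moreover have "tail (B (Suc l)) (Suc ?b') = 0"
        using Max_ge[OF fin(2)] by (intro tail_eq_0) (simp add: less_Suc_eq_le)
      moreover have "tail (B l) c = tail (B l) (Suc ?b') + (Suc ?b' - c)"
        by (rule tail_run[OF fin(1)]) (use c False seg in auto)
      moreover have "?b' < ?b"
      proof (rule ccontr)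
        assume neg: "\<not> ?b' < ?b"
        let ?s = "start l"
        have le: "?s \<le> ?b'" using start_le[OF l1(1) ne(1)] neg by simp
        have "?s \<in> B l" "?s - 1 \<in> B l" using seg[of ?s] seg[of "?s - 1"] c le by auto
        moreover have "h l ?s = h l (?s - 1)" using flat_h[of ?s] flat_h[of "?s - 1"] c le by simp
        ultimately have "g l ?s = g l (?s - 1)" using h_eq[OF l1(1), of ?s] h_eq[OF l1(1), of "?s - 1"] by simp
        then show False using start_corner[OF l1(1) ne(1)] c t1 by simp
      qed
      moreover from this have "0 < tail (B l) (Suc ?b')" using tail_pos[OF fin(1) b(1)] by simp
      ultimately show ?thesis by simp
    qed
  qed
qed

lemma swap_stage:
  assumes sw: "\<And>j. k < j \<Longrightarrow> j \<le> Suc l \<Longrightarrow> swappable j" and l: "k \<le> l" "Suc l < n"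
  shows "swap_step (Suc l) (tab (stage l)) = Some (tab (stage (Suc l)))"
proof -
  have s: "swappable (Suc l)" using sw[of "Suc l"] l by simp
  then have ne: "B (Suc l) \<noteq> {}" unfolding swappable_def by simp
  have A: "A (Suc l) = {S (Suc l)}" using A_mid l by simp
  have j: "1 \<le> Suc l" by simp
  have ht: "ht (stage l) (2 * Suc l - 1) = g (Suc l)" using sw by (intro stage_next) auto
  have "swap_step (Suc l) (tab (stage l)) = Some (tab ((stage l)(2 * Suc l - 1 := {start (Suc l)},
    2 * Suc l := insert (S (Suc l)) (stage l (2 * Suc l) - {start (Suc l)}))))"
  proof (rule swap_step_tab)
    show "valid (stage l)" using sw by (intro stage_valid) auto
    show "stage l (2 * Suc l - 1) = {S (Suc l)}" unfolding stage_next A ..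
    show "S (Suc l) \<notin> stage l (2 * Suc l)" unfolding stage_next using s unfolding swappable_def by blast
    show "start (Suc l) \<in> stage l (2 * Suc l)" unfolding stage_next using start_in[OF j ne] .
    show "start (Suc l) = 1 \<or> ht (stage l) (2 * Suc l - 1) (start (Suc l)) <
        ht (stage l) (2 * Suc l - 1) (start (Suc l) - 1)"
      unfolding ht using start_corner[OF j ne] .
    show "c \<le> start (Suc l)" if "c \<in> stage l (2 * Suc l)"
      "c = 1 \<or> ht (stage l) (2 * Suc l - 1) c < ht (stage l) (2 * Suc l - 1) (c - 1)" for c
      using that start_max[OF j ne] unfolding stage_next ht by blast
  qed simp
  also have "(stage l)(2 * Suc l - 1 := {start (Suc l)},
      2 * Suc l := insert (S (Suc l)) (stage l (2 * Suc l) - {start (Suc l)})) = stage (Suc l)"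
    using stage_Suc[of l] l m A unfolding stage_next Let_def by (simp add: A)
  finally show ?thesis .
qed

lemma stage_Suc_other:
  assumes "k \<le> l" "v \<noteq> 2 * Suc l - 1" "v \<noteq> 2 * Suc l"
  shows "stage (Suc l) v = stage l v"
  using stage_Suc[of l] assms m by (simp add: Let_def)

lemma reached_Suc:
  assumes r: "reached l" and nd: "\<not> dominates (stage l (2 * l - 1)) (stage l (2 * l + 1))"
  shows "reached (Suc l)" "swap_step (Suc l) (tab (stage l)) = Some (tab (stage (Suc l)))"
proof -
  have l: "k \<le> l" "l < n" "1 \<le> l" and swl: "\<And>j. k < j \<Longrightarrow> j \<le> l \<Longrightarrow> swappable j"
    and card_l: "k < l \<Longrightarrow> card (B m) = a - 1"
    and dom_l: "\<And>v. 1 \<le> v \<Longrightarrow> v \<noteq> 2 * l - 1 \<Longrightarrow> dominates (stage l v) (stage l (v + 2))"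
    using r m unfolding reached_def by auto
  have "2 * l + 1 = 2 * Suc l - 1" by simp
  then have nd': "\<not> dominates (stage l (2 * l - 1)) (A (Suc l))" using nd stage_next(1)[of l] by simp
  \<comment> \<open>At l + 1 = n no odd letter is left to be dominated; this bounds the number of
    swaps.\<close>
  have Sl: "Suc l < n"
  proof (rule ccontr)
    assume "\<not> ?thesis"
    then have "A (Suc l) = {}" unfolding A_def by (intro high) simp
    then show False using nd' dominates_empty by simp
  qed
  have less: "b < S (Suc l)" if "b \<in> B l" for b
    using that blocked_first blocked_later[of l] nd' Sl l swl by (cases "k = l") auto
  have card_m: "card (B m) = a - 1"
    using card_l blocked_first nd' Sl l by (cases "k = l") auto
  have ne: "B (Suc l) \<noteq> {}"
    using nonempty[of "Suc l"] card_m l Sl unfolding B_def by auto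
  have "b < S (Suc l)" if "b \<in> B (Suc l)" for b
    using dominates_ex[OF _ dom_B[OF l(3)] that] less by fastforce
  then have "swappable (Suc l)" using less ne Sl unfolding swappable_def by auto
  then have sw: "swappable j" if "k < j" "j \<le> Suc l" for j
    using swl that by (cases "j = Suc l") auto
  show "swap_step (Suc l) (tab (stage l)) = Some (tab (stage (Suc l)))"
    using swap_stage[OF sw] l Sl by blast
  let ?t = "start (Suc l)" and ?x = "S (Suc l)"
  have t: "1 \<le> ?t" "?t < ?x" using start_ge[of "Suc l"] ne start_less[of "Suc l"] sw[of "Suc l"] l by auto
  have A: "A (Suc l) = {?x}" using A_mid l Sl by simp
  have val: "valid (stage (Suc l))" using sw by (rule stage_valid)
  have "dominates (stage (Suc l) v) (stage (Suc l) (v + 2))" if v: "1 \<le> v" "v \<noteq> 2 * Suc l - 1" for v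
  proof -
    \<comment> \<open>The swap touches only 2l + 1 and 2l + 2, so three comparisons need an
      argument; v = 2l + 1 is the newly permitted exception.\<close>
    consider "v = 2 * l - 1" | "v = 2 * l" | "v = 2 * Suc l" | "v \<notin> {2 * l - 1, 2 * l, 2 * l + 1, 2 * l + 2}"
      using v by fastforce
    then show ?thesis
    proof cases
      case 1
      then have "v + 2 = 2 * Suc l - 1" using l by simp
      moreover have "stage (Suc l) (2 * Suc l - 1) = {?t}" using stage_odd[of "Suc l"] l Sl by simp
      moreover have "stage (Suc l) v = stage l (2 * l - 1)" using 1 l by (simp add: stage_Suc_other)
      moreover have "\<exists>y\<in>stage l (2 * l - 1). ?t \<le> y"
      proof (cases "k = l")
        case True
        then show ?thesis using blocked_first nd' Sl t unfolding stage_k_odd[unfolded True] True by auto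
      next
        case False
        then show ?thesis using start_Suc_le[of l] sw[of l] sw[of "Suc l"] l Sl stage_odd[of l] by auto
      qed
      moreover have "finite (stage l (2 * l - 1))" using valid_finite[OF stage_valid[OF swl]] l by auto
      ultimately show ?thesis using dominates_single by auto
    next
      case 2
      then have v2: "v + 2 = 2 * Suc l" by simp
      show ?thesis
        unfolding dominates_def
      proof
        fix c
        have le: "tail (B (Suc l)) c \<le> tail (B l) c" using tail_B_le l by simp
        have 1: "tail (stage (Suc l) v) c + of_bool (k < l \<and> c \<le> start l) =
            tail (B l) c + of_bool (c \<le> S l)"
          using tail_stage_even[where l = "Suc l" and j = l and c = c, OF sw] l m unfolding 2 by simp
        have 2: "tail (stage (Suc l) (v + 2)) c + of_bool (c \<le> ?t) = tail (B (Suc l)) c + of_bool (c \<le> ?x)"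
          using tail_stage_even[where l = "Suc l" and j = "Suc l" and c = c, OF sw] l m unfolding v2 by simp
        show "tail (stage (Suc l) (v + 2)) c \<le> tail (stage (Suc l) v) c"
        proof (cases "k = l")
          case True
          then have "?x = S l" using blocked_first nd' Sl by simp
          then show ?thesis using 1 2 le True by simp
        next
          case False
          then have kl: "k < l" using l by simp
          have "\<exists>y\<in>A l. ?x \<le> y" using dominates_ex[OF _ dom_A[OF l(3)], of ?x] A by simp
          then have xS: "?x \<le> S l" using A_mid kl l by simp
          have tt: "?t \<le> start l" using start_Suc_le[of l] sw[of l] sw[of "Suc l"] kl Sl by simp
          have tx: "start l < ?x" using blocked_later[of l] kl Sl swl nd' by simp
          have "tail (B (Suc l)) c < tail (B l) c" if "?t < c" "c \<le> start l"
            using swap_strict[of l] that sw[of l] sw[of "Suc l"] kl Sl by simp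
          then show ?thesis using 1 2 le xS tt tx kl
            by (cases "c \<le> ?t"; cases "c \<le> start l"; cases "c \<le> ?x"; cases "c \<le> S l") auto
        qed
      qed
    next
      case 3
      show ?thesis
        unfolding dominates_def
      proof
        fix c
        have v2: "v + 2 = 2 * Suc (Suc l)" using 3 by simp
        have 1: "tail (stage (Suc l) v) c + of_bool (c \<le> ?t) = tail (B (Suc l)) c + of_bool (c \<le> ?x)"
          using tail_stage_even[where l = "Suc l" and j = "Suc l" and c = c, OF sw] l m unfolding 3 by simp
        have 2: "stage (Suc l) (v + 2) = B (Suc (Suc l))"
          unfolding v2 by (rule stage_next(2))
        show "tail (stage (Suc l) (v + 2)) c \<le> tail (stage (Suc l) v) c"
          unfolding 2 using 1 tail_B_le[of "Suc l" c] t by (cases "c \<le> ?t"; cases "c \<le> ?x") auto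
      qed
    next
      case 4
      then have "stage (Suc l) v = stage l v" "stage (Suc l) (v + 2) = stage l (v + 2)"
        using l v 4 by (intro stage_Suc_other; auto)+
      then show ?thesis using dom_l[of v] 4 v by simp
    qed
  qed
  then show "reached (Suc l)" unfolding reached_def using l Sl sw card_m by auto
qed

end

section \<open>Peelability of the stages and termination\<close>

context raised_family
begin

lemma stage_before: "1 \<le> j \<Longrightarrow> j < m \<Longrightarrow> stage l (2 * j - 1) = A j \<and> stage l (2 * j) = B j"
  unfolding stage_def exch_even using exch_odd[of j] m by (simp add: A_def B_def)

lemma stage_raised:
  assumes "k \<le> l" "m \<le> j" "j \<le> k"
  shows "stage l (2 * j - 1) = A j - {S j} \<and> stage l (2 * j) = insert (S j) (B j)"
  unfolding stage_def exch_even using exch_odd[of j] m assms by (simp add: A_def B_def)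

lemma stage_swapped:
  assumes "k < j" "j \<le> l"
  shows "stage l (2 * j - 1) = A j - {S j} \<union> {start j} \<and> stage l (2 * j) = insert (S j) (B j - {start j})"
  unfolding stage_def exch_even using exch_odd[of j] m assms by (simp add: A_def B_def)

lemma stage_after: "l < j \<Longrightarrow> stage l (2 * j - 1) = A j \<and> stage l (2 * j) = B j"
  unfolding stage_def exch_even using exch_odd[of j] by (simp add: A_def B_def)

lemma card_stage:
  assumes r: "reached l" and j: "1 \<le> j"
  shows "card (stage l (2 * j - 1)) + of_bool (m \<le> j \<and> j \<le> k) = card (C (2 * j - 1))"
    and "card (stage l (2 * j)) = card (C (2 * j)) + of_bool (m \<le> j \<and> j \<le> k)"
proof -
  have sw: "swappable j" if "k < j" "j \<le> l" for j using r that unfolding reached_def by blast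
  have l: "k \<le> l" using r unfolding reached_def by simp
  show "card (stage l (2 * j - 1)) + of_bool (m \<le> j \<and> j \<le> k) = card (C (2 * j - 1))"
    using tail_stage_odd[where l = l and j = j and c = 0, OF sw j] l m
    unfolding tail_0 A_def by (cases "j \<le> k") auto
  show "card (stage l (2 * j)) = card (C (2 * j)) + of_bool (m \<le> j \<and> j \<le> k)"
    using tail_stage_even[where l = l and j = j and c = 0, OF sw j] l m
    unfolding tail_0 B_def by (cases "j \<le> k") auto
qed

context
  fixes nu rho :: "nat \<Rightarrow> int"
  assumes nu: "is_partition n nu" and rho: "is_partition n rho"
    and nu_eq: "\<And>j. 1 \<le> j \<Longrightarrow> nu j = int (card (C (2 * j - 1))) - of_bool (m \<le> j \<and> j \<le> k)"
    and rho_eq: "\<And>j. 1 \<le> j \<Longrightarrow> rho j = int (card (C (2 * j))) + of_bool (m \<le> j \<and> j \<le> k)"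
begin

text \<open>From stage k on the content is right, as swaps keep the sizes of the sets. What remains
  is the one domination that \<open>reached\<close> leaves open.\<close>

lemma peelable_stage:
  assumes r: "reached l"
  shows "peelable nu rho (tab (stage l)) \<longleftrightarrow> dominates (stage l (2 * l - 1)) (stage l (2 * l + 1))"
proof -
  have val: "valid (stage l)" using r unfolding reached_def by (intro stage_valid) blast
  have content: "int (card (stage l v)) = interleaved_content nu rho v" if "1 \<le> v" for v
    using that
  proof (cases rule: letter_cases)
    case (1 j)
    have "odd v" "(v + 1) div 2 = j" using 1 by auto
    then have "interleaved_content nu rho v = nu j" unfolding interleaved_content_def by presburger
    moreover have "int (card (stage l v)) + of_bool (m \<le> j \<and> j \<le> k) = int (card (C (2 * j - 1)))"
      using card_stage(1)[OF r 1(1)] unfolding 1(2) by (metis of_nat_add of_nat_of_bool)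
    ultimately show ?thesis using nu_eq[OF 1(1)] by linarith
  next
    case (2 j)
    then show ?thesis using card_stage(2)[OF r 2(1)] rho_eq[OF 2(1)]
      by (simp add: interleaved_content_def)
  qed
  have l: "1 \<le> l" using r m unfolding reached_def by simp
  have "(\<forall>v\<ge>1. dominates (stage l v) (stage l (v + 2))) \<longleftrightarrow>
    dominates (stage l (2 * l - 1)) (stage l (2 * l + 1))"
  proof -
    have "1 \<le> 2 * l - 1" "2 * l - 1 + 2 = 2 * l + 1" using l by simp_all
    moreover have "\<forall>v\<ge>1. v \<noteq> 2 * l - 1 \<longrightarrow> dominates (stage l v) (stage l (v + 2))"
      using r unfolding reached_def by blast
    ultimately show ?thesis by metis
  qed
  then show ?thesis unfolding peelable_tab[OF val nu rho] using content by blast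
qed

lemma swap_until_peelable_stage:
  assumes "reached l"
  shows "\<exists>l'. reached l' \<and> peelable nu rho (tab (stage l')) \<and>
    swap_until_peelable nu rho (Suc l) (tab (stage l)) = Some (tab (stage l'))"
  using assms
proof (induction "n - l" arbitrary: l rule: less_induct)
  case less
  show ?case
  proof (cases "peelable nu rho (tab (stage l))")
    case True
    then show ?thesis using less.prems by (subst swap_until_peelable.simps) auto
  next
    case False
    then have nd: "\<not> dominates (stage l (2 * l - 1)) (stage l (2 * l + 1))"
      using peelable_stage less.prems by simp
    note next_stage = reached_Suc[OF less.prems nd]
    have "l < n" using less.prems unfolding reached_def by blast
    then have "n - Suc l < n - l" by simp
    from less.hyps[OF this next_stage(1)] show ?thesis
      using False next_stage(2) by (subst swap_until_peelable.simps) simp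
  qed
qed

lemma theta_stage:
  "\<exists>l. reached l \<and> peelable nu rho (tab (stage l)) \<and> theta m k nu rho (tab C) = Some (tab (stage l))"
  using swap_until_peelable_stage[OF reached_k] raise_steps_stage[of "k - m"] m
  by (simp add: theta_def)

end

end

lemma (in family) raised_familyI:
  obtains F S where "raised_family C n m k a F S"
proof (rule raisable_sequence)
  fix F S
  assume FS: "\<And>j. m \<le> j \<Longrightarrow> j \<le> k \<Longrightarrow> raisable j (F j) (S j)"
    "leftmost_from m 0 (S m)" "\<And>j. m \<le> j \<Longrightarrow> j < k \<Longrightarrow> leftmost_from (Suc j) (S j) (S (Suc j))"
  have "raised_family C n m k a F (\<lambda>j. if j \<le> k then S j else the_elem (A j))"
    by unfold_locales (use FS m in auto)
  then show thesis by (rule that)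
qed

section \<open>Recovering the tableau from its image\<close>

lemma stage_inj_aux:
  assumes "raised_family C n m k a F S" and "raised_family D n m k a G R"
    and X: "raised_family.reached C n m k a S l" and Y: "raised_family.reached D n m k a R l'"
    and eq: "\<And>v. 1 \<le> v \<Longrightarrow> raised_family.stage C m k S l v = raised_family.stage D m k R l' v"
    and le: "l \<le> l'" and v: "1 \<le> v"
  shows "C v = D v"
proof -
  interpret X: raised_family C n m k a F S by fact
  interpret Y: raised_family D n m k a G R by fact
  have kl: "k \<le> l" "l < n" "l' < n" using X Y unfolding X.reached_def Y.reached_def by auto
  have swX: "X.swappable j" if "k < j" "j \<le> l" for j using X that unfolding X.reached_def by blast
  have swY: "Y.swappable j" if "k < j" "j \<le> l'" for j using Y that unfolding Y.reached_def by blast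
  have odd: "X.stage l (2 * j - 1) = Y.stage l' (2 * j - 1)" and even: "X.stage l (2 * j) = Y.stage l' (2 * j)"
    if "1 \<le> j" for j using eq[of "2 * j - 1"] eq[of "2 * j"] that by auto
  have same: "X.A j = Y.A j \<and> X.B j = Y.B j" if j: "1 \<le> j" "j \<le> l" for j
  proof -
    consider "j < m" | "m \<le> j" "j \<le> k" | "k < j" using X.m by linarith
    then show ?thesis
    proof cases
      case 1
      then show ?thesis using X.stage_before[OF j(1)] Y.stage_before[OF j(1)] odd[OF j(1)] even[OF j(1)] by simp
    next
      case 2
      have sX: "X.stage l (2 * j - 1) = {1..a} - {S j}" "X.stage l (2 * j) = insert (S j) (X.B j)"
        using X.stage_raised[of l j] X.A_low[of j] 2 j kl by auto
      have sY: "Y.stage l' (2 * j - 1) = {1..a} - {R j}" "Y.stage l' (2 * j) = insert (R j) (Y.B j)"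
        using Y.stage_raised[of l' j] Y.A_low[of j] 2 j kl le by auto
      have "S j = R j" using odd[OF j(1)] X.S_low(1)[OF 2] Y.S_low(1)[OF 2] unfolding sX sY by blast
      moreover have "S j \<notin> X.B j" "R j \<notin> Y.B j" using X.S_low(2)[OF 2] Y.S_low(2)[OF 2] by auto
      ultimately have "X.B j = Y.B j" using even[OF j(1)] unfolding sX sY by (metis insert_ident)
      then show ?thesis using X.A_low[of j] Y.A_low[of j] 2 j by simp
    next
      case 3
      have sX: "X.stage l (2 * j - 1) = {X.start j}" "X.stage l (2 * j) = insert (S j) (X.B j - {X.start j})"
        using X.stage_swapped[of j l] X.A_mid[of j] 3 j kl by auto
      have sY: "Y.stage l' (2 * j - 1) = {Y.start j}" "Y.stage l' (2 * j) = insert (R j) (Y.B j - {Y.start j})"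
        using Y.stage_swapped[of j l'] Y.A_mid[of j] 3 j kl le by auto
      have t: "X.start j = Y.start j" using odd[OF j(1)] unfolding sX sY by simp
      have ne: "X.B j \<noteq> {}" "Y.B j \<noteq> {}" and less: "\<forall>b\<in>X.B j. b < S j" "\<forall>b\<in>Y.B j. b < R j"
        using swX[of j] swY[of j] 3 j le unfolding X.swappable_def Y.swappable_def by auto
      note ev = even[OF j(1), unfolded sX sY t]
      \<comment> \<open>Otherwise each of the two columns is an original even letter of the other
        family, and so strictly West of the other column.\<close>
      have x: "S j = R j"
      proof (rule ccontr)
        assume "S j \<noteq> R j"
        moreover have "S j \<in> insert (R j) (Y.B j - {Y.start j})" "R j \<in> insert (S j) (X.B j - {Y.start j})"
          using insertI1[of "S j" "X.B j - {Y.start j}"] insertI1[of "R j" "Y.B j - {Y.start j}"] ev by simp_all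
        ultimately have "S j \<in> Y.B j" "R j \<in> X.B j" by auto
        then have "S j < R j" "R j < S j" using less by blast+
        then show False by simp
      qed
      have "S j \<notin> X.B j" "R j \<notin> Y.B j" using less by auto
      then have "X.B j - {Y.start j} = Y.B j - {Y.start j}"
        using ev x by (metis Diff_iff insert_ident)
      moreover have "Y.start j \<in> X.B j" "Y.start j \<in> Y.B j"
        using X.start_in[OF j(1) ne(1)] Y.start_in[OF j(1) ne(2)] t by auto
      ultimately have "X.B j = Y.B j" by (metis insert_Diff)
      then show ?thesis using X.A_mid[of j] Y.A_mid[of j] 3 j kl x by simp
    qed
  qed
  \<comment> \<open>With a further swap in D, \<open>R (Suc l)\<close> would be an untouched even
    letter of C, hence weakly West of some b in \<open>B l\<close>. But \<open>B l\<close> is common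
    to both families and lies strictly West of \<open>R (Suc l)\<close>.\<close>
  have "l = l'"
  proof (rule ccontr)
    assume "l \<noteq> l'"
    then have l: "Suc l \<le> l'" "k < Suc l" "1 \<le> l" using le kl X.m by auto
    have sw: "Y.swappable (Suc l)" using swY[of "Suc l"] l by simp
    have "R (Suc l) \<in> Y.stage l' (2 * Suc l)" using Y.stage_swapped[of "Suc l" l'] l by simp
    then have "R (Suc l) \<in> X.B (Suc l)" using even[of "Suc l"] X.stage_after[of l "Suc l"] by simp
    then have "\<exists>b\<in>X.B l. R (Suc l) \<le> b"
      using dominates_ex[OF X.finite_B X.dom_B[OF l(3)]] by simp
    then show False using same[of l] l(3) sw unfolding Y.swappable_def by fastforce
  qed
  have "X.A j = Y.A j \<and> X.B j = Y.B j" if "1 \<le> j" for j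
  proof (cases "j \<le> l")
    case False
    then show ?thesis
      using X.stage_after[of l j] Y.stage_after[of l' j] \<open>l = l'\<close> odd[OF that] even[OF that] by simp
  qed (use same that in blast)
  then show ?thesis using v unfolding X.A_def Y.A_def X.B_def Y.B_def
    by (metis letter_cases)
qed

lemma stage_inj:
  assumes C: "raised_family C n m k a F S" "raised_family.reached C n m k a S l"
    and D: "raised_family D n m k a G R" "raised_family.reached D n m k a R l'"
    and eq: "tab (raised_family.stage C m k S l) = tab (raised_family.stage D m k R l')"
  shows "tab C = tab D"
proof (rule tab_cong)
  fix v :: nat
  assume v: "1 \<le> v"
  have "raised_family.stage C m k S l v = raised_family.stage D m k R l' v" if "1 \<le> v" for v
    using eq cols_tab that by metis
  then show "C v = D v"
    using stage_inj_aux[OF C(1) D(1) C(2) D(2) _ _ v] stage_inj_aux[OF D(1) C(1) D(2) C(2) _ _ v]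
    by (metis linear)
qed

theorem theorem4p6:
  fixes n m k :: nat and a :: int and lam mu nu rho :: "nat \<Rightarrow> int"
  assumes "2 \<le> n" and "1 \<le> a" and "1 \<le> m" and "m \<le> k" and "k \<le> n - 1"
    and "lam = (\<lambda>i. if i \<in> {1..k} then a else if i \<in> {k+1..n-1} then 1 else 0)"
    and "nu = (\<lambda>i. lam i - (\<Sum>j = m..k. std_basis j i))"
    and "is_partition n lam" and "is_partition n mu" and "is_partition n nu" and "is_partition n rho"
    and "\<forall>i. lam i + mu i = nu i + rho i"
    and "(\<lambda>i. of_int (nu i)) \<in> min_alcoved_polytope n lam mu"
    and "(\<lambda>i. of_int (rho i)) \<in> min_alcoved_polytope n lam mu"
  shows "(\<forall>T \<in> Collect (peelable lam mu). theta m k nu rho T \<noteq> None) \<and>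
         (\<lambda>T. the (theta m k nu rho T)) ` Collect (peelable lam mu) \<subseteq> Collect (peelable nu rho) \<and>
         inj_on (\<lambda>T. the (theta m k nu rho T)) (Collect (peelable lam mu))"
proof -
  have k: "k < n" using assms(1,5) by simp
  have lam_low: "lam i = a" if "1 \<le> i" "i \<le> k" for i using assms(6) that by simp
  have lam_mid: "lam i = 1" if "k < i" "i < n" for i using assms(6) that by auto
  have lam_high: "lam i = 0" if "n \<le> i" for i using assms(6) that k by auto
  have nu_lam: "nu i = lam i - of_bool (m \<le> i \<and> i \<le> k)" for i
  proof -
    have "(\<Sum>j = m..k. std_basis j i) = (\<Sum>j = m..k. if j = i then 1 else 0)"
      unfolding std_basis_def by (rule sum.cong) auto
    also have "\<dots> = of_bool (m \<le> i \<and> i \<le> k)" by simp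
    finally show ?thesis using assms(7) by simp
  qed
  have rho_mu: "rho i = mu i + of_bool (m \<le> i \<and> i \<le> k)" for i
    using assms(12)[rule_format, of i] nu_lam[of i] by linarith
  have mu_n: "mu i = 0" if "n \<le> i" for i
    using assms(9) that unfolding is_partition_def int_vector_def by (cases "i = n") auto
  have alc: "min (lam i - lam j) (mu i - mu j) \<le> nu i - nu j \<and> nu i - nu j \<le> max (lam i - lam j) (mu i - mu j)"
    if "1 \<le> i" "i \<le> n" "1 \<le> j" "j \<le> n" for i j
    using assms(13) that unfolding mem_min_alcoved_polytope_iff by simp
  \<comment> \<open>The difference nu_m - nu_n = a - 1 is below lam_m - lam_n = a, so mu_m must be
    at most a - 1.\<close>
  have mu_m: "mu m < a"
    using alc[of m n] nu_lam[of m] nu_lam[of n] lam_low[of m] lam_high[of n] mu_n[of n] k assms(3,4)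
    by (auto simp: min_def split: if_splits)
  \<comment> \<open>Here nu_(m-1) - nu_m = 1 exceeds the difference 0 for lam, so mu must drop
    between these coordinates.\<close>
  have mu_strict: "mu m < mu (m - 1)" if "1 < m"
  proof -
    obtain p where p: "m = Suc p" "1 \<le> p" using \<open>1 < m\<close> by (cases m) auto
    then show ?thesis
      using alc[of p m] nu_lam[of m] nu_lam[of p] lam_low[of m] lam_low[of p] k assms(4)
      by (auto simp: max_def split: if_splits)
  qed
  have a2: "2 \<le> a" if "k + 1 < n"
  proof -
    have "nu (k + 1) \<le> nu k" using assms(3,4,10) that unfolding is_partition_def by simp
    then show ?thesis using nu_lam[of k] nu_lam[of "k + 1"] lam_low[of k] lam_mid[of "k + 1"] that assms(3,4) by simp
  qed
  have mu_pos: "1 \<le> mu j" if "mu m = a - 1" "k + 1 < n" "1 \<le> j" "j < n" for j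
  proof -
    have "1 \<le> n - 1" "k < n - 1" "n - 1 < n" using that by auto
    \<comment> \<open>The difference for nu at m and n - 1 is a - 2, below the a - 1 for lam; hence
      a - 1 - mu_(n-1) <= a - 2.\<close>
    then have "1 \<le> mu (n - 1)"
      using alc[of m "n - 1"] nu_lam[of m] nu_lam[of "n - 1"] lam_low[of m] lam_mid[of "n - 1"] that assms(3,4)
      by (auto simp: min_def split: if_splits)
    moreover have "mu (n - 1) \<le> mu j" using assms(9) that unfolding is_partition_def by simp
    ultimately show ?thesis by simp
  qed
  have main: "\<exists>C F S l. T = tab C \<and> raised_family C n m k (nat a) F S \<and>
      raised_family.reached C n m k (nat a) S l \<and>
      peelable nu rho (tab (raised_family.stage C m k S l)) \<and>
      theta m k nu rho T = Some (tab (raised_family.stage C m k S l))"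
    if T: "peelable lam mu T" for T
  proof -
    have ss: "semistandard T" using T unfolding peelable_def by blast
    define C where "C = cols T"
    have val: "valid C" and tab: "tab C = T"
      unfolding C_def using valid_cols[OF ss] tab_cols[OF ss] by auto
    have content: "int (card (C v)) = interleaved_content lam mu v"
      and doms: "dominates (C v) (C (v + 2))" if "1 \<le> v" for v
      using T that unfolding tab[symmetric] peelable_tab[OF val assms(8,9)] by auto
    have odd: "int (card (C (2 * j - 1))) = lam j" if "1 \<le> j" for j
    proof -
      have "odd (2 * j - 1)" "(2 * j - 1 + 1) div 2 = j" "1 \<le> 2 * j - 1" using that by auto
      then show ?thesis using content[of "2 * j - 1"] unfolding interleaved_content_def by presburger
    qed
    have even: "int (card (C (2 * j))) = mu j" if "1 \<le> j" for j
      using content[of "2 * j"] that by (simp add: interleaved_content_def)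
    have "family C n m k (nat a)"
    proof
      show "valid C" "1 \<le> m" "m \<le> k" "k < n" by (fact val assms(3,4) k)+
      show "card (C (2 * j - 1)) = nat a" if "1 \<le> j" "j \<le> k" for j
        using odd[of j] lam_low[of j] that by simp
      show "card (C (2 * j - 1)) = 1" if "k < j" "j < n" for j
        using odd[of j] lam_mid[of j] that by simp
      show "C (2 * j - 1) = {}" if "n \<le> j" for j
        using odd[of j] lam_high[of j] that k valid_finite[OF val, of "2 * j - 1"] by simp
      show "C (2 * j) = {}" if "n \<le> j" for j
        using even[of j] mu_n[of j] that k valid_finite[OF val, of "2 * j"] by simp
      show "dominates (C v) (C (v + 2))" if "1 \<le> v" for v using doms that .
      show "card (C (2 * m)) < nat a" using even[of m] mu_m assms(3) by simp
      show "card (C (2 * m)) < card (C (2 * (m - 1)))" if "1 < m"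
      proof -
        have "1 \<le> m - 1" "1 \<le> m" using that by auto
        then show ?thesis using even[of m] even[of "m - 1"] mu_strict[OF that] by linarith
      qed
      show "2 \<le> nat a" if "k + 1 < n" using a2 that by simp
      show "C (2 * j) \<noteq> {}" if "card (C (2 * m)) = nat a - 1" "k + 1 < n" "1 \<le> j" "j < n" for j
        using mu_pos[of j] even[of m] even[of j] that assms(2,3) by auto
    qed
    then obtain F S where "raised_family C n m k (nat a) F S" by (rule family.raised_familyI)
    then interpret raised_family C n m k "nat a" F S .
    have "\<exists>l. reached l \<and> peelable nu rho (tab (stage l)) \<and> theta m k nu rho (tab C) = Some (tab (stage l))"
      by (rule theta_stage[OF assms(10,11)]) (use odd even nu_lam rho_mu in simp_all)
    then show ?thesis using tab \<open>raised_family C n m k (nat a) F S\<close> by metis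
  qed
  have "T = U" if TU: "peelable lam mu T" "peelable lam mu U" "theta m k nu rho T = theta m k nu rho U" for T U
    using main[OF TU(1)] main[OF TU(2)] TU(3) stage_inj by (metis option.inject)
  moreover have "\<exists>U. theta m k nu rho T = Some U \<and> peelable nu rho U" if "peelable lam mu T" for T
    using main[OF that] by blast
  ultimately show ?thesis
    by (intro conjI inj_onI ballI image_subsetI; simp only: mem_Collect_eq) (metis option.distinct(1) option.sel)+
qed

end
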